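(* Let $f_i:\mathbb{R}^{n_i}\to\mathbb{R}\cup\{\pm\infty\}$ ($i=1,\dots,n$) be proper, lower semi-continuous functions with bounded domains, let $A_i$ be real $m\times n_i$ matrices, and let $b\in\mathbb{R}^m$. Let $p$ be the optimal value of the primal problem $$\min\ \sum_{i=1}^n f_i(x^i)\quad\text{subject to}\quad \sum_{i=1}^n A_i x^i\le b,\qquad x^i\in\mathbb{R}^{n_i},$$ and let $d$ be the optimal value of the dual problem $$\max\ -\sum_{i=1}^n f_i^*(-A_i^T y)-b^T y\quad\text{subject to}\quad y\ge 0,\qquad y\in\mathbb{R}^m.$$ Assume that the primal problem is feasible, i.e. $p<+\infty$. Then there exist integers $k_1,\dots,k_n$ with $1\le k_i\le m+1$ for all $i$ and $\sum_{i=1}^n k_i\le m+n$ such that the duality gap satisfies $$p-d\le\sum_{i=1}^n\rho^{k_i}(f_i).$$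
   Context: A function $f:\mathbb{R}^n\to\mathbb{R}\cup\{\pm\infty\}$ is proper if it never takes the value $-\infty$ and its domain $\operatorname{dom} f=\{x: f(x)<+\infty\}$ is nonempty. Vector inequalities are componentwise. The conjugate of $f$ is $f^*(u)=\sup_{x}\{u^T x-f(x)\}$. Optimal values of the minimization and maximization problems are understood as the infimum and supremum, respectively (the infimum being $+\infty$ if no feasible point has finite objective value). For an integer $k\ge 1$, the $k$th nonconvexity of a proper function $f$ is $$\rho^k(f)=\sup\Big\{f\Big(\sum_{j=1}^k\alpha_j x^j\Big)-\sum_{j=1}^k\alpha_j f(x^j)\Big\}\in[0,+\infty],$$ the supremum being over all $x^1,\dots,x^k\in\operatorname{dom} f$ and all $\alpha_1,\dots,\alpha_k\ge 0$ with $\sum_{j=1}^k\alpha_j=1$. *)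

theory Defs
  imports "HOL-Analysis.Analysis"
begin

text \<open>
  The blocks of variables live in spaces \<open>\<real>\<^sup>n\<close> whose dimension depends on the block, so
  \<open>\<real>\<^sup>n\<close> is the carrier of the library topology \<^const>\<open>Euclidean_space\<close>: the sequences
  \<open>x :: nat \<Rightarrow> real\<close> with \<open>x j = 0\<close> for \<open>j \<ge> n\<close> (coordinates are numbered \<open>0, \<dots>, n - 1\<close>).
  The number \<open>m\<close> of constraints is the same throughout, so \<open>\<real>\<^sup>m\<close> is the type \<open>real ^ 'm\<close>,
  on which \<open>\<le>\<close> is the componentwise order.
\<close>

abbreviation Rn :: "nat \<Rightarrow> (nat \<Rightarrow> real) set"
  where "Rn n \<equiv> topspace (Euclidean_space n)"

definition effdom :: "nat \<Rightarrow> ((nat \<Rightarrow> real) \<Rightarrow> ereal) \<Rightarrow> (nat \<Rightarrow> real) set"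
  where "effdom n f = {x \<in> Rn n. f x < \<infinity>}"

definition proper :: "nat \<Rightarrow> ((nat \<Rightarrow> real) \<Rightarrow> ereal) \<Rightarrow> bool"
  where "proper n f \<longleftrightarrow> (\<forall>x\<in>Rn n. f x \<noteq> - \<infinity>) \<and> effdom n f \<noteq> {}"

definition lsc :: "nat \<Rightarrow> ((nat \<Rightarrow> real) \<Rightarrow> ereal) \<Rightarrow> bool"
  where "lsc n f \<longleftrightarrow> (\<forall>x\<in>Rn n. f x \<le> Liminf (atin (Euclidean_space n) x) f)"

text \<open>
  Boundedness in the Euclidean norm. The predicate \<^const>\<open>bounded\<close> on \<open>nat \<Rightarrow> real\<close> would
  refer to the library metric on countable products, for which every set is bounded.
\<close>

definition bounded_Rn :: "nat \<Rightarrow> (nat \<Rightarrow> real) set \<Rightarrow> bool"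
  where "bounded_Rn n S \<longleftrightarrow> (\<exists>B. \<forall>x\<in>S. L2_set x {..<n} \<le> B)"

definition conjugate :: "nat \<Rightarrow> ((nat \<Rightarrow> real) \<Rightarrow> ereal) \<Rightarrow> (nat \<Rightarrow> real) \<Rightarrow> ereal"
  where "conjugate n f u = (SUP x\<in>Rn n. ereal (\<Sum>j<n. u j * x j) - f x)"

definition nonconvexity :: "nat \<Rightarrow> nat \<Rightarrow> ((nat \<Rightarrow> real) \<Rightarrow> ereal) \<Rightarrow> ereal"
  where "nonconvexity n k f =
    Sup {f (\<lambda>t. \<Sum>j=1..k. \<alpha> j * x j t) - (\<Sum>j=1..k. ereal (\<alpha> j) * f (x j)) | \<alpha> x.
      (\<forall>j\<in>{1..k}. x j \<in> effdom n f \<and> 0 \<le> \<alpha> j) \<and> (\<Sum>j=1..k. \<alpha> j) = (1::real)}"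

text \<open>
  A real \<open>m \<times> n\<close> matrix is given by its entries \<open>A r j\<close>, \<open>r :: 'm\<close>, \<open>j < n\<close>; entries with
  \<open>j \<ge> n\<close> are never used.
\<close>

definition mat_app :: "nat \<Rightarrow> ('m::finite \<Rightarrow> nat \<Rightarrow> real) \<Rightarrow> (nat \<Rightarrow> real) \<Rightarrow> real ^ 'm"
  where "mat_app n A x = (\<chi> r. \<Sum>j<n. A r j * x j)"

definition transp_app :: "nat \<Rightarrow> ('m::finite \<Rightarrow> nat \<Rightarrow> real) \<Rightarrow> real ^ 'm \<Rightarrow> nat \<Rightarrow> real"
  where "transp_app n A y = (\<lambda>j. if j < n then \<Sum>r\<in>UNIV. A r j * y $ r else 0)"

text \<open>Blocks are numbered \<open>1, \<dots>, n\<close>, and block \<open>i\<close> has dimension \<open>N i\<close>.\<close>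

definition primal_value ::
  "nat \<Rightarrow> (nat \<Rightarrow> nat) \<Rightarrow> (nat \<Rightarrow> (nat \<Rightarrow> real) \<Rightarrow> ereal) \<Rightarrow>
   (nat \<Rightarrow> 'm::finite \<Rightarrow> nat \<Rightarrow> real) \<Rightarrow> real ^ 'm \<Rightarrow> ereal"
  where "primal_value n N f A b =
    Inf {(\<Sum>i=1..n. f i (x i)) | x.
      (\<forall>i\<in>{1..n}. x i \<in> Rn (N i)) \<and> (\<Sum>i=1..n. mat_app (N i) (A i) (x i)) \<le> b}"

definition dual_value ::
  "nat \<Rightarrow> (nat \<Rightarrow> nat) \<Rightarrow> (nat \<Rightarrow> (nat \<Rightarrow> real) \<Rightarrow> ereal) \<Rightarrow>
   (nat \<Rightarrow> 'm::finite \<Rightarrow> nat \<Rightarrow> real) \<Rightarrow> real ^ 'm \<Rightarrow> ereal"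
  where "dual_value n N f A b =
    (SUP y\<in>{y. 0 \<le> y}.
      - (\<Sum>i=1..n. conjugate (N i) (f i) (\<lambda>j. - transp_app (N i) (A i) y j)) - ereal (b \<bullet> y))"

end

theory Submission
  imports Defs
begin

text \<open>
  Put \<open>S\<^sub>i = {(A\<^sub>i x, f\<^sub>i x) | x \<in> dom f\<^sub>i}\<close> and let \<open>H\<close> be the set of all points of \<open>\<real>\<^sup>m \<times> \<real>\<close>
  that dominate a point of \<open>conv S\<^sub>1 + \<dots> + conv S\<^sub>n\<close>. A basic solution of the linear program for
  the weights (cost \<open>f\<^sub>i\<close>, \<open>m\<close> coupling constraints, \<open>n\<close> normalisations) has at most \<open>m + n\<close>
  positive weights, so \<open>H\<close> is the union, over the finitely many admissible \<open>k\<close>, of the sets of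
  points dominating combinations with \<open>k\<^sub>i\<close> points in block \<open>i\<close>. Each of these sets is closed by
  compactness and lower semicontinuity. If \<open>(b, d)\<close> were not in the closed convex set \<open>H\<close>, a
  separating hyperplane, which is not vertical by primal feasibility, would give a dual point
  of value greater than \<open>d\<close>. Hence \<open>(b, d)\<close> comes from a combination with admissible \<open>k\<close>, and
  replacing the points of each block by their weighted mean gives a primal feasible point whose
  value exceeds \<open>d\<close> by at most the sum of the nonconvexities.
\<close>

subsection \<open>Basic solutions and the refined Shapley-Folkman lemma\<close>

text \<open>More vectors than the dimension are dependent. Since \<open>w\<close> is an indexed
  family, a repeated value needs its own case: there the relation is \<open>+1\<close> at one of the
  two indices and \<open>-1\<close> at the other.\<close>

lemma ex_linear_relation:
  fixes w :: "'b \<Rightarrow> 'a::euclidean_space"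
  assumes "finite J" and "DIM('a) < card J"
  shows "\<exists>\<mu>. (\<exists>j\<in>J. \<mu> j \<noteq> 0) \<and> (\<Sum>j\<in>J. \<mu> j *\<^sub>R w j) = 0"
proof (cases "inj_on w J")
  case True
  then have "dependent (w ` J)"
    using assms by (intro dependent_biggerset) (auto simp: card_image)
  then obtain u where u: "\<exists>v\<in>w ` J. u v \<noteq> 0" "(\<Sum>v\<in>w ` J. u v *\<^sub>R v) = 0"
    using assms(1) by (auto simp: dependent_finite)
  then show ?thesis
    using True by (intro exI[of _ "u \<circ> w"]) (auto simp: sum.reindex)
next
  case False
  then obtain a c where ac: "a \<in> J" "c \<in> J" "a \<noteq> c" "w a = w c"
    by (auto simp: inj_on_def)
  define \<mu> :: "'b \<Rightarrow> real" where "\<mu> = (\<lambda>j. of_bool (j = a) - of_bool (j = c))"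
  have "(\<Sum>j\<in>J. \<mu> j *\<^sub>R w j)
      = (\<Sum>j\<in>J. (if j = a then w j else 0) - (if j = c then w j else 0))"
    by (intro sum.cong) (auto simp: \<mu>_def)
  also have "\<dots> = 0"
    using ac assms(1) by (simp add: sum_subtractf)
  finally show ?thesis
    using ac by (intro exI[of _ \<mu>]) (auto simp: \<mu>_def)
qed

text \<open>
  The vectors \<open>w j\<close> are compared with the one of a representative of the class of \<open>j\<close>; a
  linear relation between these differences has zero sum on every class.
\<close>

lemma ex_balanced_relation:
  fixes w :: "'b \<Rightarrow> 'a::euclidean_space" and c :: "'b \<Rightarrow> 'i"
  assumes "finite J" and big: "DIM('a) + card (c ` J) < card J"
  shows "\<exists>\<mu>. (\<exists>j\<in>J. \<mu> j \<noteq> 0) \<and> (\<Sum>j\<in>J. \<mu> j *\<^sub>R w j) = 0 \<and>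
    (\<forall>i. (\<Sum>j\<in>{j\<in>J. c j = i}. \<mu> j) = 0)"
proof -
  define rep where "rep = (\<lambda>j. inv_into J c (c j))"
  have rep: "rep j \<in> J" "c (rep j) = c j" if "j \<in> J" for j
    using that by (auto simp: rep_def inv_into_into f_inv_into_f)
  \<comment> \<open>At a representative the difference \<open>w j - w (rep j)\<close> vanishes, so
    representatives are left out. There is at most one per class, hence more than
    \<open>DIM('a)\<close> indices remain.\<close>
  define J' where "J' = J - rep ` J"
  have "card (rep ` J) = card (inv_into J c ` c ` J)"
    by (simp add: rep_def image_image)
  also have "\<dots> \<le> card (c ` J)"
    by (rule card_image_le) (simp add: assms(1))
  finally have "DIM('a) < card J'"
    using big diff_card_le_card_Diff[of "rep ` J" J] assms(1) by (simp add: J'_def)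
  moreover have fin: "finite J'"
    by (simp add: J'_def assms(1))
  ultimately obtain \<nu> where \<nu>: "\<exists>j\<in>J'. \<nu> j \<noteq> 0"
    "(\<Sum>j\<in>J'. \<nu> j *\<^sub>R (w j - w (rep j))) = 0"
    using ex_linear_relation[of J' "\<lambda>j. w j - w (rep j)"] by blast
  \<comment> \<open>Collects the coefficient of each single index in the relation between
    differences. \<open>eval\<close> is stated for any target space because it serves both
    \<open>w\<close> and the indicator of a class.\<close>
  define \<mu> where "\<mu> x = (\<Sum>j\<in>J'. \<nu> j * (of_bool (x = j) - of_bool (x = rep j)))" for x
  have eval: "(\<Sum>x\<in>J. \<mu> x *\<^sub>R g x) = (\<Sum>j\<in>J'. \<nu> j *\<^sub>R (g j - g (rep j)))"
    for g :: "'b \<Rightarrow> 'v::real_vector"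
  proof -
    have "(\<Sum>x\<in>J. \<mu> x *\<^sub>R g x)
        = (\<Sum>x\<in>J. \<Sum>j\<in>J'. \<nu> j *\<^sub>R ((if x = j then g x else 0) - (if x = rep j then g x else 0)))"
      unfolding \<mu>_def scaleR_sum_left by (intro sum.cong) auto
    also have "\<dots> = (\<Sum>j\<in>J'. \<nu> j *\<^sub>R (\<Sum>x\<in>J. (if x = j then g x else 0) - (if x = rep j then g x else 0)))"
      by (subst sum.swap) (simp add: scaleR_sum_right)
    also have "\<dots> = (\<Sum>j\<in>J'. \<nu> j *\<^sub>R (g j - g (rep j)))"
    proof (intro sum.cong refl)
      fix j assume "j \<in> J'"
      then show "\<nu> j *\<^sub>R (\<Sum>x\<in>J. (if x = j then g x else 0) - (if x = rep j then g x else 0))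
          = \<nu> j *\<^sub>R (g j - g (rep j))"
        using rep assms(1) by (simp add: sum_subtractf J'_def)
    qed
    finally show ?thesis .
  qed
  have "(\<Sum>j\<in>{j\<in>J. c j = i}. \<mu> j) = 0" for i
  proof -
    have "(\<Sum>j\<in>{j\<in>J. c j = i}. \<mu> j) = (\<Sum>x\<in>J. if c x = i then \<mu> x else 0)"
      using assms(1) by (simp add: sum.inter_filter)
    also have "\<dots> = (\<Sum>x\<in>J. \<mu> x *\<^sub>R of_bool (c x = i))"
      by (intro sum.cong) auto
    also have "\<dots> = 0"
      unfolding eval by (intro sum.neutral) (auto simp: J'_def rep)
    finally show ?thesis .
  qed
  moreover have "(\<Sum>j\<in>J. \<mu> j *\<^sub>R w j) = 0"
    using \<nu>(2) by (simp add: eval)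
  \<comment> \<open>No index of \<open>J'\<close> is a representative, so nothing cancels
    \<open>\<nu> j\<close>; hence \<mu> is nontrivial.\<close>
  moreover have "\<mu> j = \<nu> j" if "j \<in> J'" for j
  proof -
    have "\<mu> j = (\<Sum>j'\<in>J'. if j' = j then \<nu> j' else 0)"
      unfolding \<mu>_def using that by (intro sum.cong) (auto simp: J'_def)
    then show ?thesis using that fin by simp
  qed
  moreover have "J' \<subseteq> J" by (simp add: J'_def)
  ultimately show ?thesis
    using \<nu>(1) by (intro exI[of _ \<mu>]) (metis subsetD)
qed

text \<open>
  This is the existence of basic solutions in linear programming: as long as the support is too
  large, the weights are moved along a balanced relation that does not increase the cost \<open>s\<close>,
  until one of them vanishes.
\<close>

lemma ex_basic_weights:
  fixes w :: "'b \<Rightarrow> 'a::euclidean_space" and c :: "'b \<Rightarrow> 'i" and s u :: "'b \<Rightarrow> real"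
  assumes "finite J" and "\<And>j. j \<in> J \<Longrightarrow> 0 \<le> u j"
  shows "\<exists>v. (\<forall>j\<in>J. 0 \<le> v j) \<and>
    (\<forall>i. (\<Sum>j\<in>{j\<in>J. c j = i}. v j) = (\<Sum>j\<in>{j\<in>J. c j = i}. u j)) \<and>
    (\<Sum>j\<in>J. v j *\<^sub>R w j) = (\<Sum>j\<in>J. u j *\<^sub>R w j) \<and>
    (\<Sum>j\<in>J. v j * s j) \<le> (\<Sum>j\<in>J. u j * s j) \<and>
    card {j\<in>J. v j \<noteq> 0} \<le> DIM('a) + card (c ` J)"
  using assms(2)
proof (induction "card {j\<in>J. u j \<noteq> 0}" arbitrary: u rule: less_induct)
  case less
  define P where "P = {j\<in>J. u j \<noteq> 0}"
  have P: "finite P" "P \<subseteq> J" using assms(1) by (auto simp: P_def)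
  show ?case
  proof (cases "card P \<le> DIM('a) + card (c ` J)")
    case True
    then show ?thesis
      using less.prems by (intro exI[of _ u]) (simp add: P_def)
  next
    case False
    moreover have "card (c ` P) \<le> card (c ` J)"
      using P assms(1) by (intro card_mono image_mono) auto
    ultimately obtain \<nu> where \<nu>: "\<exists>j\<in>P. \<nu> j \<noteq> 0" "(\<Sum>j\<in>P. \<nu> j *\<^sub>R w j) = 0"
      "\<And>i. (\<Sum>j\<in>{j\<in>P. c j = i}. \<nu> j) = 0"
      using ex_balanced_relation[OF P(1), of c w] by force
    \<comment> \<open>Both \<nu> and its negative are balanced; the sign is the one for which moving
      along \<mu> does not raise the cost.\<close>
    define \<sigma> :: real where "\<sigma> = (if (\<Sum>j\<in>P. \<nu> j * s j) \<le> 0 then 1 else -1)"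
    define \<mu> where "\<mu> = (\<lambda>j. if j \<in> P then \<sigma> * \<nu> j else 0)"
    have restr: "(\<Sum>j\<in>X. \<mu> j *\<^sub>R g j) = \<sigma> *\<^sub>R (\<Sum>j\<in>X \<inter> P. \<nu> j *\<^sub>R g j)"
      if "X \<subseteq> J" for X and g :: "'b \<Rightarrow> 'v::real_vector"
    proof -
      have "finite X" using that assms(1) finite_subset by blast
      then have "(\<Sum>j\<in>X. \<mu> j *\<^sub>R g j) = (\<Sum>j\<in>X \<inter> P. \<mu> j *\<^sub>R g j)"
        by (intro sum.mono_neutral_right) (auto simp: \<mu>_def)
      also have "\<dots> = \<sigma> *\<^sub>R (\<Sum>j\<in>X \<inter> P. \<nu> j *\<^sub>R g j)"
        unfolding scaleR_sum_right by (intro sum.cong) (auto simp: \<mu>_def)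
      finally show ?thesis .
    qed
    have JP: "J \<inter> P = P" using P by auto
    have \<mu>0: "(\<Sum>j\<in>J. \<mu> j *\<^sub>R w j) = 0"
      using restr[of J w] \<nu>(2) by (simp add: JP)
    have \<mu>s: "(\<Sum>j\<in>J. \<mu> j * s j) \<le> 0"
      using restr[of J s] by (auto simp: JP \<sigma>_def)
    have \<mu>c: "(\<Sum>j\<in>{j\<in>J. c j = i}. \<mu> j) = 0" for i
    proof -
      have "{j\<in>J. c j = i} \<inter> P = {j\<in>P. c j = i}" using P by auto
      then show ?thesis
        using restr[of "{j\<in>J. c j = i}" "\<lambda>_. 1::real"] \<nu>(3)[of i] by simp
    qed
    \<comment> \<open>A nonzero entry forces a negative one, since the entries of its class add up
      to 0.\<close>
    have "\<exists>j\<in>P. \<mu> j < 0"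
    proof (rule ccontr)
      assume *: "\<not> ?thesis"
      obtain j where j: "j \<in> P" "\<nu> j \<noteq> 0" using \<nu>(1) by blast
      have "\<forall>l\<in>{l\<in>J. c l = c j}. \<mu> l = 0"
        using \<mu>c[of "c j"] * assms(1)
        by (subst (asm) sum_nonneg_eq_0_iff) (auto simp: \<mu>_def not_less)
      then show False using j P by (auto simp: \<mu>_def \<sigma>_def split: if_splits)
    qed
    define Q where "Q = {j\<in>P. \<mu> j < 0}"
    have Q: "finite Q" "Q \<noteq> {}" using P \<open>\<exists>j\<in>P. \<mu> j < 0\<close> by (auto simp: Q_def)
    \<comment> \<open>Ratio test of the simplex method: the largest step that keeps the weights
      nonnegative. The minimiser \<open>q\<close> leaves the support, and no index enters it because
      \<mu> vanishes outside \<open>P\<close>.\<close>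
    define t where "t = Min ((\<lambda>j. u j / - \<mu> j) ` Q)"
    have "t \<in> (\<lambda>j. u j / - \<mu> j) ` Q"
      unfolding t_def using Q by (intro Min_in) auto
    then obtain q where q: "q \<in> Q" "t = u q / - \<mu> q" by blast
    have tle: "t \<le> u j / - \<mu> j" if "j \<in> Q" for j
      unfolding t_def using Q that by (intro Min_le) auto
    have t0: "0 \<le> t"
      unfolding q(2) using q(1) less.prems[of q] P by (auto simp: Q_def intro!: divide_nonneg_neg)
    define u' where "u' = (\<lambda>j. u j + t * \<mu> j)"
    have u'0: "0 \<le> u' j" if "j \<in> J" for j
    proof (cases "j \<in> Q")
      case True
      then have "\<mu> j < 0" by (simp add: Q_def)
      with tle[OF True] show ?thesis by (simp add: u'_def field_simps)
    next
      case False
      then have "0 \<le> \<mu> j" by (auto simp: Q_def \<mu>_def)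
      then show ?thesis using t0 less.prems[OF that] by (simp add: u'_def)
    qed
    have "\<mu> q \<noteq> 0" using q(1) by (auto simp: Q_def)
    then have "u' q = 0" by (simp add: u'_def q(2))
    moreover have "u' j = 0" if "j \<in> J" "j \<notin> P" for j
      using that by (simp add: u'_def P_def \<mu>_def)
    ultimately have "{j\<in>J. u' j \<noteq> 0} \<subseteq> P - {q}" by auto
    moreover have "P - {q} \<subset> P" using q by (auto simp: Q_def)
    ultimately have "card {j\<in>J. u' j \<noteq> 0} < card P"
      using P(1) by (meson psubset_card_mono subset_psubset_trans)
    then obtain v where v: "\<forall>j\<in>J. 0 \<le> v j"
      "\<forall>i. (\<Sum>j\<in>{j\<in>J. c j = i}. v j) = (\<Sum>j\<in>{j\<in>J. c j = i}. u' j)"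
      "(\<Sum>j\<in>J. v j *\<^sub>R w j) = (\<Sum>j\<in>J. u' j *\<^sub>R w j)"
      "(\<Sum>j\<in>J. v j * s j) \<le> (\<Sum>j\<in>J. u' j * s j)"
      "card {j\<in>J. v j \<noteq> 0} \<le> DIM('a) + card (c ` J)"
      using less.hyps[of u'] u'0 unfolding P_def by blast
    have move: "(\<Sum>j\<in>X. u' j *\<^sub>R g j) = (\<Sum>j\<in>X. u j *\<^sub>R g j) + t *\<^sub>R (\<Sum>j\<in>X. \<mu> j *\<^sub>R g j)"
      for X and g :: "'b \<Rightarrow> 'v::real_vector"
      by (simp add: u'_def scaleR_add_left sum.distrib scaleR_sum_right)
    have "(\<Sum>j\<in>J. u' j *\<^sub>R w j) = (\<Sum>j\<in>J. u j *\<^sub>R w j)"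
      using move[of w J] \<mu>0 by simp
    moreover have "(\<Sum>j\<in>{j\<in>J. c j = i}. u' j) = (\<Sum>j\<in>{j\<in>J. c j = i}. u j)" for i
      using move[of "\<lambda>_. 1::real" "{j\<in>J. c j = i}"] \<mu>c[of i] by simp
    moreover have "(\<Sum>j\<in>J. u' j * s j) \<le> (\<Sum>j\<in>J. u j * s j)"
      using move[of s J] mult_nonneg_nonpos[OF t0 \<mu>s] by simp
    ultimately show ?thesis
      using v by (intro exI[of _ v]) auto
  qed
qed

text \<open>Finite convex combinations representing the \<open>p i\<close> are pooled into one
  family indexed by pairs \<open>(i, t)\<close>, with the blocks as classes, \<open>fst t\<close> as
  vectors and \<open>snd t\<close> as costs; basic weights then give the count. The last coordinate
  is only bounded from above, so it is a cost and not one more equation: this is why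
  \<open>DIM('a)\<close> appears and not \<open>DIM('a) + 1\<close>.\<close>

lemma refined_shapley_folkman:
  fixes S :: "'i \<Rightarrow> ('a::euclidean_space \<times> real) set"
  assumes "finite I" and p: "\<And>i. i \<in> I \<Longrightarrow> p i \<in> convex hull S i"
  shows "\<exists>T v. (\<forall>i\<in>I. finite (T i) \<and> T i \<noteq> {} \<and> T i \<subseteq> S i \<and> (\<forall>t\<in>T i. 0 \<le> v i t) \<and> sum (v i) (T i) = 1) \<and>
    (\<Sum>i\<in>I. card (T i)) \<le> DIM('a) + card I \<and>
    (\<Sum>i\<in>I. \<Sum>t\<in>T i. v i t *\<^sub>R fst t) = (\<Sum>i\<in>I. fst (p i)) \<and>
    (\<Sum>i\<in>I. \<Sum>t\<in>T i. v i t * snd t) \<le> (\<Sum>i\<in>I. snd (p i))"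
proof -
  have "\<forall>i\<in>I. \<exists>U u. finite U \<and> U \<subseteq> S i \<and> (\<forall>t\<in>U. 0 \<le> u t) \<and> sum u U = 1 \<and>
      (\<Sum>t\<in>U. u t *\<^sub>R t) = p i"
    using p by (auto simp: convex_hull_explicit)
  from bchoice[OF this] obtain U where "\<forall>i\<in>I. \<exists>u. finite (U i) \<and> U i \<subseteq> S i \<and>
      (\<forall>t\<in>U i. 0 \<le> u t) \<and> sum u (U i) = 1 \<and> (\<Sum>t\<in>U i. u t *\<^sub>R t) = p i" ..
  from bchoice[OF this] obtain u where "\<forall>i\<in>I. finite (U i) \<and> U i \<subseteq> S i \<and>
      (\<forall>t\<in>U i. 0 \<le> u i t) \<and> sum (u i) (U i) = 1 \<and> (\<Sum>t\<in>U i. u i t *\<^sub>R t) = p i" ..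
  then have U: "finite (U i) \<and> U i \<subseteq> S i \<and>
      (\<forall>t\<in>U i. 0 \<le> u i t) \<and> sum (u i) (U i) = 1 \<and> (\<Sum>t\<in>U i. u i t *\<^sub>R t) = p i"
    if "i \<in> I" for i
    using that by blast
  define J where "J = Sigma I U"
  have "finite J" using assms(1) U by (auto simp: J_def)
  moreover have "0 \<le> u (fst j) (snd j)" if "j \<in> J" for j
    using that U by (auto simp: J_def)
  ultimately have "\<exists>v. (\<forall>j\<in>J. 0 \<le> v j) \<and>
      (\<forall>i. (\<Sum>j\<in>{j\<in>J. fst j = i}. v j) = (\<Sum>j\<in>{j\<in>J. fst j = i}. u (fst j) (snd j))) \<and>
      (\<Sum>j\<in>J. v j *\<^sub>R fst (snd j)) = (\<Sum>j\<in>J. u (fst j) (snd j) *\<^sub>R fst (snd j)) \<and>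
      (\<Sum>j\<in>J. v j * snd (snd j)) \<le> (\<Sum>j\<in>J. u (fst j) (snd j) * snd (snd j)) \<and>
      card {j\<in>J. v j \<noteq> 0} \<le> DIM('a) + card (fst ` J)"
    by (rule ex_basic_weights)
  then obtain v where v: "\<forall>j\<in>J. 0 \<le> v j"
    "\<forall>i. (\<Sum>j\<in>{j\<in>J. fst j = i}. v j) = (\<Sum>j\<in>{j\<in>J. fst j = i}. u (fst j) (snd j))"
    "(\<Sum>j\<in>J. v j *\<^sub>R fst (snd j)) = (\<Sum>j\<in>J. u (fst j) (snd j) *\<^sub>R fst (snd j))"
    "(\<Sum>j\<in>J. v j * snd (snd j)) \<le> (\<Sum>j\<in>J. u (fst j) (snd j) * snd (snd j))"
    "card {j\<in>J. v j \<noteq> 0} \<le> DIM('a) + card (fst ` J)"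
    by (elim exE conjE) (rule that)
  \<comment> \<open>Only points of nonzero weight are kept, so the \<open>T i\<close> together are
    exactly the support of \<open>v\<close>.\<close>
  define T where "T i = {t\<in>U i. v (i, t) \<noteq> 0}" for i
  have drop: "(\<Sum>t\<in>T i. v (i, t) *\<^sub>R g t) = (\<Sum>t\<in>U i. v (i, t) *\<^sub>R g t)" if "i \<in> I"
    for i and g :: "'a \<times> real \<Rightarrow> 'v::real_vector"
    using U[OF that] by (intro sum.mono_neutral_left) (auto simp: T_def)
  have fibre: "{j\<in>J. fst j = i} = Pair i ` U i" if "i \<in> I" for i
    using that by (auto simp: J_def)
  have total: "(\<Sum>i\<in>I. \<Sum>t\<in>U i. g i t) = (\<Sum>j\<in>J. g (fst j) (snd j))"
    for g :: "'i \<Rightarrow> 'a \<times> real \<Rightarrow> 'v::real_vector"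
    unfolding J_def using assms(1) U by (subst sum.Sigma) (auto simp: case_prod_unfold)
  have sum1: "(\<Sum>t\<in>T i. v (i, t)) = 1" if "i \<in> I" for i
    using spec[OF v(2), of i] drop[OF that, of "\<lambda>_. 1::real"] U[OF that]
    by (simp add: fibre[OF that] sum.reindex inj_on_def)
  have "(\<Sum>i\<in>I. card (T i)) = card (Sigma I T)"
    using assms(1) U by (subst card_SigmaI) (auto simp: T_def)
  also have "Sigma I T = {j\<in>J. v j \<noteq> 0}"
    by (auto simp: T_def J_def)
  also have "card \<dots> \<le> DIM('a) + card (fst ` J)" by (rule v(5))
  also have "card (fst ` J) \<le> card I"
    using assms(1) by (intro card_mono) (auto simp: J_def)
  finally have "(\<Sum>i\<in>I. card (T i)) \<le> DIM('a) + card I" by simp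
  moreover have "(\<Sum>i\<in>I. \<Sum>t\<in>T i. v (i, t) *\<^sub>R fst t) = (\<Sum>i\<in>I. fst (p i))"
  proof -
    have "(\<Sum>i\<in>I. \<Sum>t\<in>T i. v (i, t) *\<^sub>R fst t) = (\<Sum>i\<in>I. \<Sum>t\<in>U i. v (i, t) *\<^sub>R fst t)"
      by (simp add: drop)
    also have "\<dots> = (\<Sum>i\<in>I. \<Sum>t\<in>U i. u i t *\<^sub>R fst t)"
      unfolding total using v(3) by simp
    also have "\<dots> = (\<Sum>i\<in>I. fst (p i))"
      using U by (intro sum.cong refl) (metis (no_types, lifting) fst_scaleR fst_sum sum.cong)
    finally show ?thesis .
  qed
  moreover have "(\<Sum>i\<in>I. \<Sum>t\<in>T i. v (i, t) * snd t) \<le> (\<Sum>i\<in>I. snd (p i))"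
  proof -
    have "(\<Sum>i\<in>I. \<Sum>t\<in>T i. v (i, t) * snd t) = (\<Sum>i\<in>I. \<Sum>t\<in>U i. v (i, t) * snd t)"
      using drop[of _ snd] by simp
    also have "\<dots> \<le> (\<Sum>i\<in>I. \<Sum>t\<in>U i. u i t * snd t)"
      unfolding total using v(4) by simp
    also have "\<dots> = (\<Sum>i\<in>I. snd (p i))"
    proof (intro sum.cong refl)
      fix i assume "i \<in> I"
      then have "snd (p i) = snd (\<Sum>t\<in>U i. u i t *\<^sub>R t)" using U by simp
      then show "(\<Sum>t\<in>U i. u i t * snd t) = snd (p i)" by (simp add: snd_sum)
    qed
    finally show ?thesis .
  qed
  moreover have "finite (T i) \<and> T i \<noteq> {} \<and> T i \<subseteq> S i \<and> (\<forall>t\<in>T i. 0 \<le> v (i, t)) \<and>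
      (\<Sum>t\<in>T i. v (i, t)) = 1" if "i \<in> I" for i
  proof -
    have "T i \<subseteq> U i" by (auto simp: T_def)
    moreover have "\<forall>t\<in>U i. 0 \<le> v (i, t)" using v(1) that by (auto simp: J_def)
    moreover have "T i \<noteq> {}" using sum1[OF that] by auto
    ultimately show ?thesis using U[OF that] sum1[OF that] by (meson finite_subset subset_iff)
  qed
  ultimately show ?thesis
    by (intro exI[of _ T] exI[of _ "\<lambda>i t. v (i, t)"] conjI ballI) blast+
qed

subsection \<open>Lower semicontinuity and compactness\<close>

definition lsc_on :: "'a::topological_space set \<Rightarrow> ('a \<Rightarrow> ereal) \<Rightarrow> bool"
  where "lsc_on K F \<longleftrightarrow> (\<forall>x\<in>K. F x \<le> Liminf (at x within K) F)"

lemma lsc_on_sequentially: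
  assumes "lsc_on K F" "x \<in> K" "\<And>l. X l \<in> K" "X \<longlonglongrightarrow> x" "c < F x"
  shows "\<forall>\<^sub>F l in sequentially. c < F (X l)"
proof -
  have "\<forall>\<^sub>F y in at x within K. c < F y"
    using assms(1,2,5) unfolding lsc_on_def by (intro less_LiminfD) (auto intro: less_le_trans)
  \<comment> \<open>The filter \<open>at x within K\<close> omits \<open>x\<close>; terms of the
    sequence equal to \<open>x\<close> are covered by \<open>c < F x\<close>.\<close>
  then have "\<forall>\<^sub>F y in nhds x. y \<in> K \<longrightarrow> c < F y"
    unfolding eventually_at_filter using assms(5) by (auto elim!: eventually_mono)
  then have "\<forall>\<^sub>F l in sequentially. X l \<in> K \<longrightarrow> c < F (X l)"
    using assms(4) by (rule eventually_compose_filterlim)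
  then show ?thesis using assms(3) by simp
qed

text \<open>A sequence with values tending to -\<infinity> would accumulate at some \<open>x\<close>
  in \<open>K\<close>, while lower semicontinuity keeps the values near \<open>x\<close> above a
  real number \<open>c\<close> below \<open>F x\<close>.\<close>

lemma lsc_on_compact_bounded_below:
  fixes K :: "'a::metric_space set"
  assumes "compact K" "lsc_on K F" "\<And>x. x \<in> K \<Longrightarrow> F x \<noteq> - \<infinity>"
  shows "\<exists>M::real. \<forall>x\<in>K. ereal M < F x"
proof (rule ccontr)
  assume "\<not> ?thesis"
  then have "\<forall>l::nat. \<exists>x\<in>K. F x \<le> ereal (- real l)"
    by (metis not_le)
  then obtain X where X: "\<And>l. X l \<in> K" "\<And>l. F (X l) \<le> ereal (- real l)"
    by metis
  obtain x r where x: "x \<in> K" "strict_mono r" "(X \<circ> r) \<longlonglongrightarrow> x"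
    using compact_imp_seq_compact[OF assms(1)] X(1) by (meson seq_compactE)
  have "- \<infinity> < F x" using assms(3)[OF x(1)] by (simp add: less_le)
  then obtain c where c: "ereal c < F x" using ereal_dense2 by blast
  have "\<forall>\<^sub>F l in sequentially. ereal c < F ((X \<circ> r) l)"
    using lsc_on_sequentially[OF assms(2) x(1) _ x(3) c] X(1) by simp
  then obtain L where L: "\<And>l. l \<ge> L \<Longrightarrow> ereal c < F (X (r l))"
    by (auto simp: eventually_sequentially)
  obtain l where l: "L \<le> l" "- c \<le> real l"
    by (metis max.cobounded1 max.cobounded2 max.coboundedI2 of_nat_mono order_trans real_arch_simple)
  have "real l \<le> real (r l)" using seq_suble[OF x(2), of l] by simp
  moreover have "ereal c < ereal (- real (r l))"
    using L[OF l(1)] X(2)[of "r l"] by (rule less_le_trans)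
  ultimately show False using l(2) by simp
qed

text \<open>
  A point whose weight tends to \<open>0\<close> may leave the effective domain in the limit; since \<open>F\<close> is
  bounded below, its contribution to the limit is nonnegative and can be dropped.
\<close>

lemma lsc_weighted_sum_limit:
  fixes F :: "'p \<Rightarrow> 'x::topological_space \<Rightarrow> ereal"
  assumes "finite P"
    and lsc: "\<And>p. p \<in> P \<Longrightarrow> lsc_on (K p) (F p)"
    and M: "\<And>p x. p \<in> P \<Longrightarrow> x \<in> K p \<Longrightarrow> ereal (M p) < F p x"
    and X: "\<And>p l. p \<in> P \<Longrightarrow> X l p \<in> K p" "\<And>p l. p \<in> P \<Longrightarrow> F p (X l p) < \<infinity>"
    and y: "\<And>p. p \<in> P \<Longrightarrow> (\<lambda>l. X l p) \<longlonglongrightarrow> y p" "\<And>p. p \<in> P \<Longrightarrow> y p \<in> K p"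
    and \<alpha>: "\<And>p l. p \<in> P \<Longrightarrow> 0 \<le> \<alpha> l p" "\<And>p. p \<in> P \<Longrightarrow> (\<lambda>l. \<alpha> l p) \<longlonglongrightarrow> a p"
    and r: "\<And>l. (\<Sum>p\<in>P. \<alpha> l p * real_of_ereal (F p (X l p))) \<le> r l" "r \<longlonglongrightarrow> R"
  shows "\<forall>p\<in>P. a p \<noteq> 0 \<longrightarrow> F p (y p) < \<infinity>"
    and "(\<Sum>p\<in>P. a p * real_of_ereal (F p (y p))) \<le> R"
proof -
  have a0: "0 \<le> a p" if "p \<in> P" for p
    using \<alpha>(2)[OF that] by (rule LIMSEQ_le_const) (use \<alpha>(1) that in blast)
  have below: "(\<Sum>p\<in>P. a p * c p) \<le> R"
    if c: "\<And>p. p \<in> P \<Longrightarrow> a p \<noteq> 0 \<Longrightarrow> ereal (c p) < F p (y p)" for c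
  proof -
    \<comment> \<open>Where the limit weight is 0 there is no bound \<open>c p\<close>; the global
      bound \<open>M p\<close> stands in, and its contribution disappears in the limit.\<close>
    define c' where "c' p = (if a p = 0 then M p else c p)" for p
    have "\<forall>\<^sub>F l in sequentially. ereal (c' p) < F p (X l p)" if "p \<in> P" for p
      by (rule lsc_on_sequentially[where x = "y p" and K = "K p"])
        (use that lsc X y c M in \<open>auto simp: c'_def\<close>)
    then have "\<forall>\<^sub>F l in sequentially. \<forall>p\<in>P. ereal (c' p) < F p (X l p)"
      using assms(1) by (intro eventually_ball_finite) auto
    then have "\<forall>\<^sub>F l in sequentially. (\<Sum>p\<in>P. \<alpha> l p * c' p) \<le> r l"
    proof (rule eventually_mono)
      fix l assume l: "\<forall>p\<in>P. ereal (c' p) < F p (X l p)"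
      have "c' p \<le> real_of_ereal (F p (X l p))" if "p \<in> P" for p
        using l X(2)[OF that, of l] that by (cases "F p (X l p)") auto
      then have "(\<Sum>p\<in>P. \<alpha> l p * c' p) \<le> (\<Sum>p\<in>P. \<alpha> l p * real_of_ereal (F p (X l p)))"
        using \<alpha>(1) by (intro sum_mono mult_left_mono) auto
      also have "\<dots> \<le> r l" by (rule r(1))
      finally show "(\<Sum>p\<in>P. \<alpha> l p * c' p) \<le> r l" .
    qed
    moreover have "(\<lambda>l. \<Sum>p\<in>P. \<alpha> l p * c' p) \<longlonglongrightarrow> (\<Sum>p\<in>P. a p * c' p)"
      using \<alpha>(2) by (intro tendsto_sum tendsto_mult tendsto_const) auto
    ultimately have "(\<Sum>p\<in>P. a p * c' p) \<le> R"
      using tendsto_le[OF trivial_limit_sequentially r(2)] by blast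
    also have "(\<Sum>p\<in>P. a p * c' p) = (\<Sum>p\<in>P. a p * c p)"
      by (intro sum.cong) (auto simp: c'_def)
    finally show ?thesis .
  qed
  show fin: "\<forall>p\<in>P. a p \<noteq> 0 \<longrightarrow> F p (y p) < \<infinity>"
  proof (intro ballI impI, rule ccontr)
    fix q assume q: "q \<in> P" "a q \<noteq> 0" "\<not> F q (y q) < \<infinity>"
    \<comment> \<open>If \<open>F q (y q)\<close> were infinite, every real would be an admissible
      bound at \<open>q\<close>. This one makes the left side of \<open>below\<close> equal to
      \<open>R + 1\<close>.\<close>
    define C where "C = (R - (\<Sum>p\<in>P - {q}. a p * M p) + 1) / a q"
    have "(\<Sum>p\<in>P. a p * (if p = q then C else M p)) \<le> R"
      by (rule below) (use q y M in auto)
    moreover have "(\<Sum>p\<in>P. a p * (if p = q then C else M p))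
        = a q * C + (\<Sum>p\<in>P - {q}. a p * M p)"
      using assms(1) q(1) by (subst sum.remove[of _ q]) (auto intro!: sum.cong)
    moreover have "a q * C = R - (\<Sum>p\<in>P - {q}. a p * M p) + 1"
      using q(2) by (simp add: C_def)
    ultimately show False by simp
  qed
  define S where "S = (\<Sum>p\<in>P. a p * real_of_ereal (F p (y p)))"
  \<comment> \<open>\<open>below\<close> asks for strict lower bounds, so the values are lowered by
    \<open>e\<close>, and then \<open>e\<close> tends to 0.\<close>
  have "S \<le> R + e * sum a P" if "0 < e" for e
  proof -
    have "(\<Sum>p\<in>P. a p * (real_of_ereal (F p (y p)) - e)) \<le> R"
    proof (rule below)
      fix p assume p: "p \<in> P" "a p \<noteq> 0"
      then show "ereal (real_of_ereal (F p (y p)) - e) < F p (y p)"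
        using fin M[OF p(1) y(2)[OF p(1)]] that by (cases "F p (y p)") auto
    qed
    then show ?thesis
      by (simp add: S_def algebra_simps sum_subtractf sum_distrib_left)
  qed
  moreover have "((\<lambda>e. R + e * sum a P) \<longlongrightarrow> R + 0 * sum a P) (at_right 0)"
    by (intro tendsto_intros)
  ultimately have "S \<le> R + 0 * sum a P"
    by (intro tendsto_lowerbound[where F = "at_right (0::real)"])
      (auto simp: eventually_at_right_less intro: eventually_mono[OF eventually_at_right_less])
  then show "(\<Sum>p\<in>P. a p * real_of_ereal (F p (y p))) \<le> R"
    by (simp add: S_def)
qed

text \<open>The number of slots per block is fixed, but points may repeat and weights may vanish, so
  limits stay within the same \<open>k\<close>. The inequality for the cost matches what lower
  semicontinuity can preserve.\<close>

definition slot_sums ::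
  "'i set \<Rightarrow> ('i \<Rightarrow> nat) \<Rightarrow> ('i \<Rightarrow> 'x set) \<Rightarrow> ('i \<Rightarrow> 'x \<Rightarrow> 'a::ordered_euclidean_space) \<Rightarrow>
   ('i \<Rightarrow> 'x \<Rightarrow> real) \<Rightarrow> ('a \<times> real) set"
  where "slot_sums I k D g h = {(z, r). \<exists>\<alpha> x.
    (\<forall>i\<in>I. (\<forall>j\<in>{1..k i}. x i j \<in> D i \<and> 0 \<le> \<alpha> i j) \<and> (\<Sum>j=1..k i. \<alpha> i j) = 1) \<and>
    (\<Sum>i\<in>I. \<Sum>j=1..k i. \<alpha> i j *\<^sub>R g i (x i j)) \<le> z \<and>
    (\<Sum>i\<in>I. \<Sum>j=1..k i. \<alpha> i j * h i (x i j)) \<le> r}"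

lemma compact_PiE_UNIV:
  fixes C :: "'i \<Rightarrow> 'a::topological_space set"
  assumes "\<And>i. compact (C i)"
  shows "compact (PiE UNIV C)"
  using compactin_PiE[of "\<lambda>_::'i. euclidean :: 'a topology" UNIV C] assms
  by (simp add: euclidean_product_topology)

lemma LIMSEQ_le_eucl:
  fixes X Y :: "nat \<Rightarrow> 'a::ordered_euclidean_space"
  assumes "X \<longlonglongrightarrow> x" "Y \<longlonglongrightarrow> y" "\<And>l. X l \<le> Y l"
  shows "x \<le> y"
proof (rule iffD2[OF eucl_le], rule ballI)
  fix e :: 'a assume e: "e \<in> Basis"
  have "(\<lambda>l. X l \<bullet> e) \<longlonglongrightarrow> x \<bullet> e" "(\<lambda>l. Y l \<bullet> e) \<longlonglongrightarrow> y \<bullet> e"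
    by (intro tendsto_inner tendsto_const assms)+
  moreover have "\<forall>l. X l \<bullet> e \<le> Y l \<bullet> e"
    using assms(3) e iffD1[OF eucl_le] by blast
  ultimately show "x \<bullet> e \<le> y \<bullet> e"
    by (intro LIMSEQ_le) auto
qed

text \<open>Weights and points range over a compact product, so along a subsequence all of them
  converge. Continuity of \<open>g\<close> handles the first component and
  \<open>lsc_weighted_sum_limit\<close> the second.\<close>

lemma closed_slot_sums:
  fixes K :: "'i::countable \<Rightarrow> 'x::metric_space set"
  assumes "finite I"
    and K: "\<And>i. i \<in> I \<Longrightarrow> compact (K i)"
    and lsc: "\<And>i. i \<in> I \<Longrightarrow> lsc_on (K i) (F i)"
    and ninf: "\<And>i x. i \<in> I \<Longrightarrow> x \<in> K i \<Longrightarrow> F i x \<noteq> - \<infinity>"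
    and D: "\<And>i. i \<in> I \<Longrightarrow> D i = {x \<in> K i. F i x < \<infinity>}" "\<And>i. i \<in> I \<Longrightarrow> D i \<noteq> {}"
    and g: "\<And>i. i \<in> I \<Longrightarrow> continuous_on (K i) (g i)"
  shows "closed (slot_sums I k D g (\<lambda>i x. real_of_ereal (F i x)))"
  unfolding closed_sequential_limits
proof (intro allI impI, elim conjE)
  let ?R = "\<lambda>i x. real_of_ereal (F i x)"
  fix Q q assume Q: "\<forall>l::nat. Q l \<in> slot_sums I k D g ?R" "Q \<longlonglongrightarrow> q"
  have "\<forall>l. \<exists>\<alpha> x.
    (\<forall>i\<in>I. (\<forall>j\<in>{1..k i}. x i j \<in> D i \<and> 0 \<le> \<alpha> i j) \<and> (\<Sum>j=1..k i. \<alpha> i j) = 1) \<and>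
    (\<Sum>i\<in>I. \<Sum>j=1..k i. \<alpha> i j *\<^sub>R g i (x i j)) \<le> fst (Q l) \<and>
    (\<Sum>i\<in>I. \<Sum>j=1..k i. \<alpha> i j * ?R i (x i j)) \<le> snd (Q l)" (is "\<forall>l. ?goal l")
  proof
    fix l
    have "(fst (Q l), snd (Q l)) \<in> slot_sums I k D g ?R" using Q(1) by simp
    then show "?goal l" unfolding slot_sums_def mem_Collect_eq case_prod_conv .
  qed
  from choice[OF this] obtain \<alpha> where "\<forall>l. \<exists>x.
    (\<forall>i\<in>I. (\<forall>j\<in>{1..k i}. x i j \<in> D i \<and> 0 \<le> \<alpha> l i j) \<and> (\<Sum>j=1..k i. \<alpha> l i j) = 1) \<and>
    (\<Sum>i\<in>I. \<Sum>j=1..k i. \<alpha> l i j *\<^sub>R g i (x i j)) \<le> fst (Q l) \<and>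
    (\<Sum>i\<in>I. \<Sum>j=1..k i. \<alpha> l i j * ?R i (x i j)) \<le> snd (Q l)" ..
  from choice[OF this] obtain x where "\<forall>l.
    (\<forall>i\<in>I. (\<forall>j\<in>{1..k i}. x l i j \<in> D i \<and> 0 \<le> \<alpha> l i j) \<and> (\<Sum>j=1..k i. \<alpha> l i j) = 1) \<and>
    (\<Sum>i\<in>I. \<Sum>j=1..k i. \<alpha> l i j *\<^sub>R g i (x l i j)) \<le> fst (Q l) \<and>
    (\<Sum>i\<in>I. \<Sum>j=1..k i. \<alpha> l i j * ?R i (x l i j)) \<le> snd (Q l)" ..
  then have
    x: "\<And>l i j. i \<in> I \<Longrightarrow> j \<in> {1..k i} \<Longrightarrow> x l i j \<in> D i" and
    \<alpha>: "\<And>l i j. i \<in> I \<Longrightarrow> j \<in> {1..k i} \<Longrightarrow> 0 \<le> \<alpha> l i j" and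
    \<alpha>1: "\<And>l i. i \<in> I \<Longrightarrow> (\<Sum>j=1..k i. \<alpha> l i j) = 1" and
    zle: "\<And>l. (\<Sum>i\<in>I. \<Sum>j=1..k i. \<alpha> l i j *\<^sub>R g i (x l i j)) \<le> fst (Q l)" and
    rle: "\<And>l. (\<Sum>i\<in>I. \<Sum>j=1..k i. \<alpha> l i j * ?R i (x l i j)) \<le> snd (Q l)"
    by blast+
  have \<alpha>le: "\<alpha> l i j \<le> 1" if "i \<in> I" "j \<in> {1..k i}" for l i j
    using member_le_sum[of j "{1..k i}" "\<alpha> l i"] that \<alpha> \<alpha>1[of i l] by simp
  define P where "P = (SIGMA i:I. {1..k i})"
  have finP: "finite P" using assms(1) by (simp add: P_def)
  have total: "(\<Sum>i\<in>I. \<Sum>j=1..k i. G i j) = (\<Sum>p\<in>P. G (fst p) (snd p))"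
    for G :: "'i \<Rightarrow> nat \<Rightarrow> real"
    unfolding P_def using assms(1) by (subst sum.Sigma) (auto simp: case_prod_unfold)
  have Dp: "x l (fst p) (snd p) \<in> D (fst p)" if "p \<in> P" for l p
    using that x by (auto simp: P_def)
  \<comment> \<open>Coordinates outside \<open>P\<close> are pinned to one value, which turns the
    parameters into total functions in a compact product. The index type is countable so that
    compactness of this product yields convergent subsequences.\<close>
  define C where "C p = (if p \<in> P then {0..1::real} \<times> K (fst p) else {(0, undefined)})" for p
  define Y where "Y l p = (if p \<in> P then (\<alpha> l (fst p) (snd p), x l (fst p) (snd p)) else (0, undefined))"
    for l p
  have "compact (PiE UNIV C)"
    by (rule compact_PiE_UNIV) (auto simp: C_def P_def intro!: compact_Times K)
  moreover have "Y l \<in> PiE UNIV C" for l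
    using x \<alpha> \<alpha>le D by (auto simp: Y_def C_def P_def)
  ultimately obtain y \<sigma> where y: "y \<in> PiE UNIV C" "strict_mono \<sigma>" "(Y \<circ> \<sigma>) \<longlonglongrightarrow> y"
    by (meson compact_imp_seq_compact seq_compactE)
  have "(\<lambda>l. Y (\<sigma> l) p) \<longlonglongrightarrow> y p" for p
    using continuous_on_tendsto_compose[OF continuous_on_product_coordinates[of p] y(3)]
    by simp
  note lim = tendsto_fst[OF this] tendsto_snd[OF this]
  define a where "a i j = fst (y (i, j))" for i j
  define w where "w i j = snd (y (i, j))" for i j
  have \<alpha>lim: "(\<lambda>l. \<alpha> (\<sigma> l) i j) \<longlonglongrightarrow> a i j" if "i \<in> I" "j \<in> {1..k i}" for i j
    using lim(1)[of "(i, j)"] that by (simp add: Y_def a_def P_def)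
  have xlim: "(\<lambda>l. x (\<sigma> l) i j) \<longlonglongrightarrow> w i j" if "i \<in> I" "j \<in> {1..k i}" for i j
    using lim(2)[of "(i, j)"] that by (simp add: Y_def w_def P_def)
  have yC: "y p \<in> C p" for p using y(1) by auto
  have a0: "0 \<le> a i j" and wK: "w i j \<in> K i" if "i \<in> I" "j \<in> {1..k i}" for i j
    using yC[of "(i, j)"] that by (auto simp: a_def w_def C_def P_def mem_Times_iff)
  have a1: "(\<Sum>j=1..k i. a i j) = 1" if "i \<in> I" for i
  proof -
    have "(\<lambda>l. \<Sum>j=1..k i. \<alpha> (\<sigma> l) i j) \<longlonglongrightarrow> (\<Sum>j=1..k i. a i j)"
      using \<alpha>lim that by (intro tendsto_sum) auto
    then show ?thesis using \<alpha>1[OF that] by (simp add: LIMSEQ_const_iff)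
  qed
  have Qlim: "(\<lambda>l. fst (Q (\<sigma> l))) \<longlonglongrightarrow> fst q" "(\<lambda>l. snd (Q (\<sigma> l))) \<longlonglongrightarrow> snd q"
    using LIMSEQ_subseq_LIMSEQ[OF Q(2) y(2)] by (auto simp: o_def intro: tendsto_fst tendsto_snd)
  have "(\<lambda>l. \<Sum>i\<in>I. \<Sum>j=1..k i. \<alpha> (\<sigma> l) i j *\<^sub>R g i (x (\<sigma> l) i j))
      \<longlonglongrightarrow> (\<Sum>i\<in>I. \<Sum>j=1..k i. a i j *\<^sub>R g i (w i j))"
  proof (intro tendsto_sum tendsto_scaleR \<alpha>lim)
    fix i j assume ij: "i \<in> I" "j \<in> {1..k i}"
    show "(\<lambda>l. g i (x (\<sigma> l) i j)) \<longlonglongrightarrow> g i (w i j)"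
      by (rule continuous_on_tendsto_compose[OF g xlim wK])
        (use ij x[OF ij] D in auto)
  qed
  then have zlim: "(\<Sum>i\<in>I. \<Sum>j=1..k i. a i j *\<^sub>R g i (w i j)) \<le> fst q"
    by (rule LIMSEQ_le_eucl[OF _ Qlim(1)]) (rule zle)
  have "\<forall>i\<in>I. \<exists>M::real. \<forall>x\<in>K i. ereal M < F i x"
    using lsc_on_compact_bounded_below K lsc ninf by blast
  from bchoice[OF this] obtain M where M: "\<forall>i\<in>I. \<forall>x\<in>K i. ereal (M i) < F i x" ..
  have "\<forall>p\<in>P. a (fst p) (snd p) \<noteq> 0 \<longrightarrow> F (fst p) (w (fst p) (snd p)) < \<infinity>"
    and "(\<Sum>p\<in>P. a (fst p) (snd p) * ?R (fst p) (w (fst p) (snd p))) \<le> snd q"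
  proof -
    note lsc_weighted_sum_limit[where P = P and K = "\<lambda>p. K (fst p)" and F = "\<lambda>p. F (fst p)"
      and M = "\<lambda>p. M (fst p)" and X = "\<lambda>l p. x (\<sigma> l) (fst p) (snd p)"
      and y = "\<lambda>p. w (fst p) (snd p)" and \<alpha> = "\<lambda>l p. \<alpha> (\<sigma> l) (fst p) (snd p)"
      and a = "\<lambda>p. a (fst p) (snd p)" and r = "\<lambda>l. snd (Q (\<sigma> l))" and R = "snd q"]
    note * = this[OF finP]
    have mem: "fst p \<in> I" "snd p \<in> {1..k (fst p)}" if "p \<in> P" for p
      using that by (auto simp: P_def)
    have xK: "x l (fst p) (snd p) \<in> K (fst p)" "F (fst p) (x l (fst p) (snd p)) < \<infinity>"
      if "p \<in> P" for l p
      using Dp[OF that, of l] D mem[OF that] by auto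
    have r': "(\<Sum>p\<in>P. \<alpha> (\<sigma> l) (fst p) (snd p) * ?R (fst p) (x (\<sigma> l) (fst p) (snd p))) \<le> snd (Q (\<sigma> l))" for l
      using rle[of "\<sigma> l"] by (simp only: total)
    show "\<forall>p\<in>P. a (fst p) (snd p) \<noteq> 0 \<longrightarrow> F (fst p) (w (fst p) (snd p)) < \<infinity>"
      by (rule *(1)) (use mem xK lsc M r' Qlim \<alpha> \<alpha>lim xlim wK in blast)+
    show "(\<Sum>p\<in>P. a (fst p) (snd p) * ?R (fst p) (w (fst p) (snd p))) \<le> snd q"
      by (rule *(2)) (use mem xK lsc M r' Qlim \<alpha> \<alpha>lim xlim wK in blast)+
  qed
  then have wfin: "\<And>i j. i \<in> I \<Longrightarrow> j \<in> {1..k i} \<Longrightarrow> a i j \<noteq> 0 \<Longrightarrow> F i (w i j) < \<infinity>"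
    and rlim: "(\<Sum>i\<in>I. \<Sum>j=1..k i. a i j * ?R i (w i j)) \<le> snd q"
    unfolding total by (force simp: P_def)+
  have "\<forall>i\<in>I. \<exists>x. x \<in> D i" using D(2) by blast
  from bchoice[OF this] obtain d where d: "\<forall>i\<in>I. d i \<in> D i" ..
  \<comment> \<open>A limit point of weight 0 may lie outside \<open>D i\<close>; an arbitrary point
    of \<open>D i\<close> takes its slot without changing the sums.\<close>
  define x' where "x' i j = (if a i j = 0 then d i else w i j)" for i j
  have "(\<Sum>i\<in>I. \<Sum>j=1..k i. a i j *\<^sub>R g i (x' i j)) = (\<Sum>i\<in>I. \<Sum>j=1..k i. a i j *\<^sub>R g i (w i j))"
    "(\<Sum>i\<in>I. \<Sum>j=1..k i. a i j * ?R i (x' i j)) = (\<Sum>i\<in>I. \<Sum>j=1..k i. a i j * ?R i (w i j))"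
    by (intro sum.cong refl; simp add: x'_def)+
  moreover have "x' i j \<in> D i" if "i \<in> I" "j \<in> {1..k i}" for i j
    using that d wfin wK D(1) by (auto simp: x'_def)
  ultimately have "(fst q, snd q) \<in> slot_sums I k D g ?R"
    using a0 a1 zlim rlim unfolding slot_sums_def mem_Collect_eq case_prod_conv
    by (intro exI[of _ a] exI[of _ x'] conjI ballI) simp_all
  then show "q \<in> slot_sums I k D g ?R" by simp
qed

subsection \<open>Sums of convex hulls and separation\<close>

text \<open>When \<open>S i\<close> is the set of pairs of constraint vector and cost, this is, up
  to attainment of infima, the epigraph of the value function of the convexified problem, with the
  right-hand side as variable.\<close>

definition hull_sums ::
  "'i set \<Rightarrow> ('i \<Rightarrow> ('a::ordered_euclidean_space \<times> real) set) \<Rightarrow> ('a \<times> real) set"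
  where "hull_sums I S = {(z, r). \<exists>p. (\<forall>i\<in>I. p i \<in> convex hull S i) \<and>
    (\<Sum>i\<in>I. fst (p i)) \<le> z \<and> (\<Sum>i\<in>I. snd (p i)) \<le> r}"

lemma convex_hull_sums: "convex (hull_sums I S)"
proof (rule convexI)
  fix x y :: "'a \<times> real" and u v :: real
  assume x: "x \<in> hull_sums I S" and y: "y \<in> hull_sums I S" and uv: "0 \<le> u" "0 \<le> v" "u + v = 1"
  obtain p where p: "\<And>i. i \<in> I \<Longrightarrow> p i \<in> convex hull S i"
    "(\<Sum>i\<in>I. fst (p i)) \<le> fst x" "(\<Sum>i\<in>I. snd (p i)) \<le> snd x"
    using x unfolding hull_sums_def mem_Collect_eq case_prod_beta by blast
  obtain q where q: "\<And>i. i \<in> I \<Longrightarrow> q i \<in> convex hull S i"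
    "(\<Sum>i\<in>I. fst (q i)) \<le> fst y" "(\<Sum>i\<in>I. snd (q i)) \<le> snd y"
    using y unfolding hull_sums_def mem_Collect_eq case_prod_beta by blast
  have "u *\<^sub>R p i + v *\<^sub>R q i \<in> convex hull S i" if "i \<in> I" for i
    using p(1)[OF that] q(1)[OF that] uv by (intro convexD[OF convex_convex_hull]) auto
  moreover have "(\<Sum>i\<in>I. fst (u *\<^sub>R p i + v *\<^sub>R q i)) \<le> fst (u *\<^sub>R x + v *\<^sub>R y)"
    using add_mono[OF scaleR_left_mono[OF p(2) uv(1)] scaleR_left_mono[OF q(2) uv(2)]]
    by (simp add: sum.distrib scaleR_sum_right)
  moreover have "(\<Sum>i\<in>I. snd (u *\<^sub>R p i + v *\<^sub>R q i)) \<le> snd (u *\<^sub>R x + v *\<^sub>R y)"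
    using add_mono[OF mult_left_mono[OF p(3) uv(1)] mult_left_mono[OF q(3) uv(2)]]
    by (simp add: sum.distrib sum_distrib_left)
  ultimately have "(fst (u *\<^sub>R x + v *\<^sub>R y), snd (u *\<^sub>R x + v *\<^sub>R y)) \<in> hull_sums I S"
    unfolding hull_sums_def mem_Collect_eq case_prod_conv
    by (intro exI[of _ "\<lambda>i. u *\<^sub>R p i + v *\<^sub>R q i"]) blast
  then show "u *\<^sub>R x + v *\<^sub>R y \<in> hull_sums I S" by (simp only: prod.collapse)
qed

lemma slot_sums_subset_hull_sums:
  "slot_sums I k D g h \<subseteq> hull_sums I (\<lambda>i. (\<lambda>x. (g i x, h i x)) ` D i)"
proof (clarify)
  fix z r assume "(z, r) \<in> slot_sums I k D g h"
  then obtain \<alpha> x where x: "\<And>i j. i \<in> I \<Longrightarrow> j \<in> {1..k i} \<Longrightarrow> x i j \<in> D i \<and> 0 \<le> \<alpha> i j"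
    and \<alpha>: "\<And>i. i \<in> I \<Longrightarrow> (\<Sum>j=1..k i. \<alpha> i j) = 1"
    and le: "(\<Sum>i\<in>I. \<Sum>j=1..k i. \<alpha> i j *\<^sub>R g i (x i j)) \<le> z"
      "(\<Sum>i\<in>I. \<Sum>j=1..k i. \<alpha> i j * h i (x i j)) \<le> r"
    unfolding slot_sums_def by blast
  define p where "p i = (\<Sum>j=1..k i. \<alpha> i j *\<^sub>R (g i (x i j), h i (x i j)))" for i
  have "p i \<in> convex hull ((\<lambda>x. (g i x, h i x)) ` D i)" if "i \<in> I" for i
    unfolding p_def
    by (rule convex_sum[OF _ convex_convex_hull \<alpha>[OF that]]) (use x that in \<open>auto intro!: hull_inc\<close>)
  moreover have "(\<Sum>i\<in>I. fst (p i)) \<le> z" "(\<Sum>i\<in>I. snd (p i)) \<le> r"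
    using le by (simp_all add: p_def fst_sum snd_sum)
  ultimately show "(z, r) \<in> hull_sums I (\<lambda>i. (\<lambda>x. (g i x, h i x)) ` D i)"
    unfolding hull_sums_def by blast
qed

text \<open>\<open>k i\<close> is the number of points that \<open>refined_shapley_folkman\<close>
  keeps in block \<open>i\<close>; a bijection \<open>e i\<close> distributes them over the
  slots.\<close>

lemma hull_sums_subset_slot_sums:
  fixes g :: "'i \<Rightarrow> 'x \<Rightarrow> 'a::ordered_euclidean_space"
  assumes "finite I" and zr: "(z, r) \<in> hull_sums I (\<lambda>i. (\<lambda>x. (g i x, h i x)) ` D i)"
  shows "\<exists>k. k \<in> I \<rightarrow>\<^sub>E {1..DIM('a) + 1} \<and> sum k I \<le> DIM('a) + card I \<and> (z, r) \<in> slot_sums I k D g h"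
proof -
  let ?S = "\<lambda>i. (\<lambda>x. (g i x, h i x)) ` D i"
  obtain p where p: "\<And>i. i \<in> I \<Longrightarrow> p i \<in> convex hull ?S i"
    "(\<Sum>i\<in>I. fst (p i)) \<le> z" "(\<Sum>i\<in>I. snd (p i)) \<le> r"
    using zr by (auto simp: hull_sums_def)
  have "\<exists>T v. (\<forall>i\<in>I. finite (T i) \<and> T i \<noteq> {} \<and> T i \<subseteq> ?S i \<and> (\<forall>t\<in>T i. 0 \<le> v i t) \<and> sum (v i) (T i) = 1) \<and>
    (\<Sum>i\<in>I. card (T i)) \<le> DIM('a) + card I \<and>
    (\<Sum>i\<in>I. \<Sum>t\<in>T i. v i t *\<^sub>R fst t) = (\<Sum>i\<in>I. fst (p i)) \<and>
    (\<Sum>i\<in>I. \<Sum>t\<in>T i. v i t * snd t) \<le> (\<Sum>i\<in>I. snd (p i))"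
    by (rule refined_shapley_folkman[OF assms(1)]) (rule p(1))
  then obtain T v where T: "\<forall>i\<in>I. finite (T i) \<and> T i \<noteq> {} \<and> T i \<subseteq> ?S i \<and> (\<forall>t\<in>T i. 0 \<le> v i t) \<and> sum (v i) (T i) = 1"
    "(\<Sum>i\<in>I. card (T i)) \<le> DIM('a) + card I"
    "(\<Sum>i\<in>I. \<Sum>t\<in>T i. v i t *\<^sub>R fst t) = (\<Sum>i\<in>I. fst (p i))"
    "(\<Sum>i\<in>I. \<Sum>t\<in>T i. v i t * snd t) \<le> (\<Sum>i\<in>I. snd (p i))"
    by (elim exE conjE) (rule that)
  have "\<forall>i\<in>I. \<exists>e. bij_betw e {1..card (T i)} (T i)"
    using T(1) ex_bij_betw_nat_finite_1 by blast
  from bchoice[OF this] obtain e where e: "\<forall>i\<in>I. bij_betw (e i) {1..card (T i)} (T i)" ..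
  \<comment> \<open>Restricted to \<open>I\<close>, so that the admissible \<open>k\<close> form a
    finite set of extensional functions.\<close>
  define k where "k = restrict (\<lambda>i. card (T i)) I"
  have k: "k i = card (T i)" if "i \<in> I" for i using that by (simp add: k_def)
  define x where "x i j = (SOME x. x \<in> D i \<and> (g i x, h i x) = e i j)" for i j
  have x: "x i j \<in> D i \<and> (g i (x i j), h i (x i j)) = e i j" if "i \<in> I" "j \<in> {1..k i}" for i j
  proof -
    have "e i j \<in> ?S i" using T(1) e that k[OF that(1)] by (metis bij_betwE subsetD)
    then have "\<exists>x. x \<in> D i \<and> (g i x, h i x) = e i j" by auto
    then show ?thesis unfolding x_def by (rule someI_ex)
  qed
  have reindex: "(\<Sum>j=1..k i. G (e i j)) = (\<Sum>t\<in>T i. G t)" if "i \<in> I"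
    for i and G :: "'a \<times> real \<Rightarrow> 'v::comm_monoid_add"
    using sum.reindex_bij_betw[of "e i" "{1..card (T i)}" "T i" G] e that k[OF that] by simp
  have "(\<Sum>i\<in>I. \<Sum>j=1..k i. v i (e i j) *\<^sub>R g i (x i j)) = (\<Sum>i\<in>I. \<Sum>t\<in>T i. v i t *\<^sub>R fst t)"
  proof (intro sum.cong refl)
    fix i assume i: "i \<in> I"
    have "(\<Sum>j=1..k i. v i (e i j) *\<^sub>R g i (x i j)) = (\<Sum>j=1..k i. v i (e i j) *\<^sub>R fst (e i j))"
      using x[OF i] by (intro sum.cong refl) (metis fst_conv)
    then show "(\<Sum>j=1..k i. v i (e i j) *\<^sub>R g i (x i j)) = (\<Sum>t\<in>T i. v i t *\<^sub>R fst t)"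
      using reindex[OF i, of "\<lambda>t. v i t *\<^sub>R fst t"] by simp
  qed
  moreover have "(\<Sum>i\<in>I. \<Sum>j=1..k i. v i (e i j) * h i (x i j)) = (\<Sum>i\<in>I. \<Sum>t\<in>T i. v i t * snd t)"
  proof (intro sum.cong refl)
    fix i assume i: "i \<in> I"
    have "(\<Sum>j=1..k i. v i (e i j) * h i (x i j)) = (\<Sum>j=1..k i. v i (e i j) * snd (e i j))"
      using x[OF i] by (intro sum.cong refl) (metis snd_conv)
    then show "(\<Sum>j=1..k i. v i (e i j) * h i (x i j)) = (\<Sum>t\<in>T i. v i t * snd t)"
      using reindex[OF i, of "\<lambda>t. v i t * snd t"] by simp
  qed
  moreover have "0 \<le> v i (e i j)" if "i \<in> I" "j \<in> {1..k i}" for i j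
    using T(1) e that k[OF that(1)] by (metis bij_betwE)
  moreover have "(\<Sum>j=1..k i. v i (e i j)) = 1" if "i \<in> I" for i
    using reindex[OF that, of "v i"] T(1) that by simp
  ultimately have "(z, r) \<in> slot_sums I k D g h"
    unfolding slot_sums_def mem_Collect_eq case_prod_conv using x T(3,4) p(2,3)
    by (intro exI[of _ "\<lambda>i j. v i (e i j)"] exI[of _ x] conjI ballI) (simp_all del: One_nat_def)
  moreover have pos: "1 \<le> card (T i)" if "i \<in> I" for i
    using T(1) that by (simp add: Suc_le_eq card_gt_0_iff)
  \<comment> \<open>The other blocks use at least one point each, \<open>card I - 1\<close> in
    total, so the joint bound leaves at most \<open>DIM('a) + 1\<close> for block
    \<open>i\<close>.\<close>
  moreover have "card (T i) \<le> DIM('a) + 1" if i: "i \<in> I" for i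
  proof -
    have "card (I - {i}) \<le> (\<Sum>l\<in>I - {i}. card (T l))"
      using sum_mono[of "I - {i}" "\<lambda>_. 1" "\<lambda>l. card (T l)"] pos by simp
    moreover have "(\<Sum>l\<in>I. card (T l)) = card (T i) + (\<Sum>l\<in>I - {i}. card (T l))"
      using assms(1) i by (rule sum.remove)
    moreover have "card I = Suc (card (I - {i}))"
      using assms(1) i by (rule card.remove)
    ultimately show ?thesis using T(2) by linarith
  qed
  ultimately show ?thesis
    using T(2) by (intro exI[of _ k]) (auto simp: k_def)
qed

text \<open>The hulls need not be closed one by one; the bound on \<open>k\<close> makes the whole
  set a finite union of closed slot sums.\<close>

lemma closed_hull_sums:
  fixes K :: "'i::countable \<Rightarrow> 'x::metric_space set" and g :: "'i \<Rightarrow> 'x \<Rightarrow> 'a::ordered_euclidean_space"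
  assumes "finite I"
    and "\<And>i. i \<in> I \<Longrightarrow> compact (K i)"
    and "\<And>i. i \<in> I \<Longrightarrow> lsc_on (K i) (F i)"
    and "\<And>i x. i \<in> I \<Longrightarrow> x \<in> K i \<Longrightarrow> F i x \<noteq> - \<infinity>"
    and "\<And>i. i \<in> I \<Longrightarrow> D i = {x \<in> K i. F i x < \<infinity>}" "\<And>i. i \<in> I \<Longrightarrow> D i \<noteq> {}"
    and "\<And>i. i \<in> I \<Longrightarrow> continuous_on (K i) (g i)"
  shows "closed (hull_sums I (\<lambda>i. (\<lambda>x. (g i x, real_of_ereal (F i x))) ` D i))"
    (is "closed (hull_sums I ?S)")
proof -
  define N where "N = {k \<in> I \<rightarrow>\<^sub>E {1..DIM('a) + 1}. sum k I \<le> DIM('a) + card I}"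
  have "hull_sums I ?S = (\<Union>k\<in>N. slot_sums I k D g (\<lambda>i x. real_of_ereal (F i x)))"
  proof (intro equalityI subsetI)
    fix q assume "q \<in> hull_sums I ?S"
    then have "(fst q, snd q) \<in> hull_sums I ?S" by simp
    from hull_sums_subset_slot_sums[OF assms(1) this] show "q \<in> (\<Union>k\<in>N. slot_sums I k D g (\<lambda>i x. real_of_ereal (F i x)))"
      by (auto simp: N_def)
  qed (use slot_sums_subset_hull_sums in blast)
  moreover have "finite N"
    unfolding N_def using assms(1) by (intro finite_subset[OF _ finite_PiE[of I "\<lambda>_. {1..DIM('a) + 1}"]]) auto
  moreover have "closed (slot_sums I k D g (\<lambda>i x. real_of_ereal (F i x)))" for k
    by (rule closed_slot_sums[where K = K]) (use assms in blast)+
  ultimately show ?thesis by auto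
qed

text \<open>
  The hyperplane cannot be vertical, because \<open>H\<close> has a point above \<open>b\<close>; it can hence be
  normalised to be the graph of an affine function.
\<close>

lemma ex_nonvertical_separation:
  fixes H :: "('a::ordered_euclidean_space \<times> real) set"
  assumes "convex H" "closed H" "(b, r0) \<in> H" "(b, r) \<notin> H"
    and up: "\<And>z s z' s'. (z, s) \<in> H \<Longrightarrow> z \<le> z' \<Longrightarrow> s \<le> s' \<Longrightarrow> (z', s') \<in> H"
  shows "\<exists>y \<beta>. 0 \<le> y \<and> y \<bullet> b + r < \<beta> \<and> (\<forall>(z, s)\<in>H. \<beta> \<le> y \<bullet> z + s)"
proof -
  obtain a c where ac: "inner a (b, r) < c" "\<forall>q\<in>H. c < inner a q"
    using separating_hyperplane_closed_point[OF assms(1,2,4)] by blast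
  obtain w t where a: "a = (w, t)" by (cases a)
  have sep: "w \<bullet> b + t * r < c" "\<And>z s. (z, s) \<in> H \<Longrightarrow> c < w \<bullet> z + t * s"
    using ac by (auto simp: a inner_Pair)
  \<comment> \<open>An affine function bounded below on a half-line has nonnegative slope. By
    \<open>up\<close>, the set \<open>H\<close> contains the upward ray, which gives the sign of
    \<open>t\<close>, and the rays along basis vectors, which give the sign of
    \<open>w\<close>.\<close>
  have ray: "0 \<le> e" if "\<And>l::real. 0 \<le> l \<Longrightarrow> c < C + l * e" for C e
  proof (rule ccontr)
    assume "\<not> 0 \<le> e"
    then have e: "e < 0" by simp
    have "c < C + (\<bar>c - C\<bar> / - e) * e"
      using e by (intro that divide_nonneg_pos) auto
    also have "\<dots> = C - \<bar>c - C\<bar>" using e by simp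
    finally show False by linarith
  qed
  have "0 \<le> t"
  proof (rule ray)
    fix l :: real assume "0 \<le> l"
    then have "(b, r0 + l) \<in> H" by (intro up[OF assms(3)]) auto
    from sep(2)[OF this] show "c < (w \<bullet> b + t * r0) + l * t" by (simp add: algebra_simps)
  qed
  \<comment> \<open>With \<open>t = 0\<close> the points \<open>(b, r)\<close> and
    \<open>(b, r0)\<close> could not be told apart.\<close>
  moreover have "t \<noteq> 0" using sep(1) sep(2)[OF assms(3)] by auto
  ultimately have t: "0 < t" by simp
  have "0 \<le> w \<bullet> e" if "e \<in> Basis" for e
  proof (rule ray)
    fix l :: real assume "0 \<le> l"
    moreover have "0 \<le> e" using that by (rule Basis_nonneg)
    ultimately have "b \<le> b + l *\<^sub>R e" by (simp add: scaleR_nonneg_nonneg)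
    then have "(b + l *\<^sub>R e, r0) \<in> H" by (rule up[OF assms(3)]) simp
    from sep(2)[OF this] show "c < (w \<bullet> b + t * r0) + l * (w \<bullet> e)" by (simp add: inner_add_right)
  qed
  then have "0 \<le> w /\<^sub>R t"
    using t by (intro scaleR_nonneg_nonneg iffD2[OF eucl_le]) auto
  moreover have "(w /\<^sub>R t) \<bullet> b + r < c / t"
    using divide_strict_right_mono[OF sep(1) t] t by (simp add: add_divide_distrib inverse_eq_divide)
  moreover have "c / t \<le> (w /\<^sub>R t) \<bullet> z + s" if "(z, s) \<in> H" for z s
    using divide_strict_right_mono[OF sep(2)[OF that] t] t
    by (simp add: add_divide_distrib inverse_eq_divide)
  ultimately show ?thesis by blast
qed

text \<open>\<open>dual\<close> says that for every \<open>y \<ge> 0\<close> the infimum of the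
  Lagrangian over the domains is at most \<open>r\<close>. Separating \<open>(b, r)\<close> from
  \<open>H\<close> would give a \<open>y\<close> with a larger infimum; \<open>x0\<close> supplies a
  point of \<open>H\<close> on the vertical line through \<open>b\<close>.\<close>

lemma slot_sums_of_dual_bound:
  fixes K :: "'i::countable \<Rightarrow> 'x::metric_space set" and g :: "'i \<Rightarrow> 'x \<Rightarrow> 'a::ordered_euclidean_space"
  assumes "finite I"
    and K: "\<And>i. i \<in> I \<Longrightarrow> compact (K i)"
    and lsc: "\<And>i. i \<in> I \<Longrightarrow> lsc_on (K i) (F i)"
    and ninf: "\<And>i x. i \<in> I \<Longrightarrow> x \<in> K i \<Longrightarrow> F i x \<noteq> - \<infinity>"
    and D: "\<And>i. i \<in> I \<Longrightarrow> D i = {x \<in> K i. F i x < \<infinity>}" "\<And>i. i \<in> I \<Longrightarrow> D i \<noteq> {}"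
    and g: "\<And>i. i \<in> I \<Longrightarrow> continuous_on (K i) (g i)"
    and x0: "\<And>i. i \<in> I \<Longrightarrow> x0 i \<in> D i" "(\<Sum>i\<in>I. g i (x0 i)) \<le> b"
    and dual: "\<And>y \<beta>. 0 \<le> y \<Longrightarrow> r < \<beta> \<Longrightarrow>
      \<exists>x. (\<forall>i\<in>I. x i \<in> D i) \<and> (\<Sum>i\<in>I. y \<bullet> g i (x i) + real_of_ereal (F i (x i))) - y \<bullet> b < \<beta>"
  shows "\<exists>k. k \<in> I \<rightarrow>\<^sub>E {1..DIM('a) + 1} \<and> sum k I \<le> DIM('a) + card I \<and>
    (b, r) \<in> slot_sums I k D g (\<lambda>i x. real_of_ereal (F i x))"
proof -
  let ?R = "\<lambda>i x. real_of_ereal (F i x)"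
  define H where "H = hull_sums I (\<lambda>i. (\<lambda>x. (g i x, ?R i x)) ` D i)"
  have mem: "(z, s) \<in> H" if "\<forall>i\<in>I. x i \<in> D i" "(\<Sum>i\<in>I. g i (x i)) \<le> z" "(\<Sum>i\<in>I. ?R i (x i)) \<le> s"
    for x z s
    unfolding H_def hull_sums_def mem_Collect_eq case_prod_conv using that
    by (intro exI[of _ "\<lambda>i. (g i (x i), ?R i (x i))"]) (auto intro!: hull_inc)
  have "(b, r) \<in> H"
  proof (rule ccontr)
    assume "(b, r) \<notin> H"
    moreover have "closed H"
      unfolding H_def by (rule closed_hull_sums[where K = K]) (use assms in blast)+
    moreover have "(b, \<Sum>i\<in>I. ?R i (x0 i)) \<in> H"
      using x0 by (intro mem[of x0]) auto
    moreover have "(z', s') \<in> H" if "(z, s) \<in> H" "z \<le> z'" "s \<le> s'" for z s z' s'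
      using that unfolding H_def hull_sums_def by (auto intro: order_trans)
    moreover have "convex H" unfolding H_def by (rule convex_hull_sums)
    ultimately have "\<exists>y \<beta>. 0 \<le> y \<and> y \<bullet> b + r < \<beta> \<and> (\<forall>(z, s)\<in>H. \<beta> \<le> y \<bullet> z + s)"
      by (intro ex_nonvertical_separation)
    then obtain y \<beta> where y: "0 \<le> y" "y \<bullet> b + r < \<beta>" "\<forall>(z, s)\<in>H. \<beta> \<le> y \<bullet> z + s"
      by blast
    \<comment> \<open>Subtracting \<open>y \<bullet> b\<close> from the separating function gives
      the Lagrangian, so the threshold becomes \<open>\<beta> - y \<bullet> b\<close>, which exceeds
      \<open>r\<close>.\<close>
    obtain x where x: "\<forall>i\<in>I. x i \<in> D i"
      "(\<Sum>i\<in>I. y \<bullet> g i (x i) + ?R i (x i)) - y \<bullet> b < \<beta> - y \<bullet> b"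
      using dual[OF y(1), of "\<beta> - y \<bullet> b"] y(2) by auto
    have "(\<Sum>i\<in>I. g i (x i), \<Sum>i\<in>I. ?R i (x i)) \<in> H"
      using x(1) by (intro mem[of x]) auto
    then have "\<beta> \<le> y \<bullet> (\<Sum>i\<in>I. g i (x i)) + (\<Sum>i\<in>I. ?R i (x i))" using y(3) by auto
    then show False using x(2) by (simp add: inner_sum_right sum.distrib)
  qed
  then show ?thesis
    unfolding H_def by (rule hull_sums_subset_slot_sums[OF assms(1)])
qed

subsection \<open>The primal and the dual problem\<close>

text \<open>The abstract topology of \<open>Euclidean_space\<close> is the subspace topology from
  the product topology of \<open>nat \<Rightarrow> real\<close>; this carries \<open>lsc\<close>
  over to type-class filters.\<close>

lemma atin_Euclidean_space:
  assumes "x \<in> Rn n"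
  shows "atin (Euclidean_space n) x = at x within Rn n"
proof -
  have "atin (Euclidean_space n) x = atin_within euclidean x (Rn n)"
    using assms by (simp add: Euclidean_space_def euclidean_product_topology atin_subtopology_within)
  also have "\<dots> = at x within Rn n"
    by (intro filter_eqI) (auto simp: eventually_atin_within eventually_at_topological)
  finally show ?thesis .
qed

lemma lsc_imp_lsc_on:
  assumes "lsc n f" "K \<subseteq> Rn n"
  shows "lsc_on K f"
  unfolding lsc_on_def
proof
  fix x assume "x \<in> K"
  then have x: "x \<in> Rn n" using assms(2) by auto
  then have "f x \<le> Liminf (at x within Rn n) f"
    using assms(1) by (simp add: lsc_def atin_Euclidean_space)
  then show "f x \<le> Liminf (at x within K) f"
    unfolding le_Liminf_iff using at_le[OF assms(2), of x] by (blast intro: filter_leD)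
qed

text \<open>The box with the first \<open>n\<close> coordinates in \<open>[-B, B]\<close> and the
  others 0 is compact by Tychonoff. It replaces the domain, which need not be closed.\<close>

lemma bounded_Rn_imp_subset_compact:
  assumes "bounded_Rn n S" "S \<subseteq> Rn n"
  shows "\<exists>K. compact K \<and> S \<subseteq> K \<and> K \<subseteq> Rn n"
proof -
  obtain B where B: "\<And>x. x \<in> S \<Longrightarrow> L2_set x {..<n} \<le> B"
    using assms(1) by (auto simp: bounded_Rn_def)
  define C where "C j = (if j < n then {- B..B} else {0})" for j
  have "\<bar>x j\<bar> \<le> B" if "x \<in> S" "j < n" for x j
  proof -
    have "\<bar>x j\<bar> \<le> L2_set (\<lambda>j. \<bar>x j\<bar>) {..<n}"
      using that(2) by (intro member_le_L2_set) auto
    also have "\<dots> = L2_set x {..<n}" by (simp add: L2_set_def)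
    also have "\<dots> \<le> B" using that(1) by (rule B)
    finally show ?thesis .
  qed
  then have "S \<subseteq> PiE UNIV C"
    using assms(2) by (fastforce simp: C_def abs_le_iff topspace_Euclidean_space)
  moreover have "PiE UNIV C \<subseteq> Rn n"
    by (clarsimp simp: C_def topspace_Euclidean_space PiE_iff) (metis not_le singletonD)
  moreover have "compact (PiE UNIV C)"
    by (rule compact_PiE_UNIV) (auto simp: C_def)
  ultimately show ?thesis by blast
qed

section \<open>The dual objective as an infimum of the Lagrangian\<close>

lemma continuous_on_mat_app: "continuous_on S (mat_app n A)"
  unfolding mat_app_def
  by (intro continuous_on_vec_lambda continuous_on_sum continuous_on_mult continuous_on_const
      continuous_on_subset[OF continuous_on_product_coordinates subset_UNIV])

lemma mat_app_sum:
  "mat_app n A (\<lambda>t. \<Sum>j\<in>J. \<alpha> j * x j t) = (\<Sum>j\<in>J. \<alpha> j *\<^sub>R mat_app n A (x j))"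
proof -
  have "(\<Sum>t<n. A r t * (\<Sum>j\<in>J. \<alpha> j * x j t)) = (\<Sum>j\<in>J. \<alpha> j * (\<Sum>t<n. A r t * x j t))" for r
    by (simp add: sum_distrib_left mult.left_commute) (rule sum.swap)
  then show ?thesis by (simp add: mat_app_def vec_eq_iff)
qed

lemma inner_mat_app: "y \<bullet> mat_app n A x = (\<Sum>j<n. transp_app n A y j * x j)"
proof -
  have "y \<bullet> mat_app n A x = (\<Sum>r\<in>UNIV. \<Sum>j<n. A r j * y $ r * x j)"
    by (simp add: inner_vec_def mat_app_def sum_distrib_left mult_ac)
  also have "\<dots> = (\<Sum>j<n. \<Sum>r\<in>UNIV. A r j * y $ r * x j)"
    by (rule sum.swap)
  also have "\<dots> = (\<Sum>j<n. transp_app n A y j * x j)"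
    by (simp add: transp_app_def sum_distrib_right)
  finally show ?thesis .
qed

text \<open>The variables of the blocks are independent, so the supremum of the sum splits. By
  induction, fixing the point \<open>z\<close> of the new block leaves the bound
  \<open>C - h a z\<close> for the others.\<close>

lemma sum_SUP_le:
  fixes h :: "'i \<Rightarrow> 'x \<Rightarrow> real"
  assumes "finite I" "\<And>i. i \<in> I \<Longrightarrow> X i \<noteq> {}"
    and "\<And>x. (\<And>i. i \<in> I \<Longrightarrow> x i \<in> X i) \<Longrightarrow> (\<Sum>i\<in>I. h i (x i)) \<le> C"
  shows "(\<Sum>i\<in>I. SUP x\<in>X i. ereal (h i x)) \<le> ereal C"
  using assms
proof (induction I arbitrary: C rule: finite_induct)
  case empty
  then show ?case by simp
next
  case (insert a I)
  define s where "s = (\<Sum>i\<in>I. SUP x\<in>X i. ereal (h i x))"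
  have s_le: "s \<le> ereal (C - h a z)" if z: "z \<in> X a" for z
    unfolding s_def
  proof (rule insert.IH)
    fix x assume x: "\<And>i. i \<in> I \<Longrightarrow> x i \<in> X i"
    have "(\<Sum>i\<in>insert a I. h i ((x(a := z)) i)) \<le> C"
      using x z by (intro insert.prems(2)) auto
    moreover have "(\<Sum>i\<in>I. h i ((x(a := z)) i)) = (\<Sum>i\<in>I. h i (x i))"
      using insert.hyps(2) by (intro sum.cong) auto
    ultimately show "(\<Sum>i\<in>I. h i (x i)) \<le> C - h a z"
      using insert.hyps by simp
  qed (use insert.prems(1) in auto)
  \<comment> \<open>Any selection bounds \<open>s\<close> from below and \<open>s_le\<close> bounds
    it from above; being real, \<open>s\<close> may be moved across an inequality in
    \<open>ereal\<close>.\<close>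
  have "\<forall>i\<in>I. \<exists>x. x \<in> X i" using insert.prems(1) by auto
  from bchoice[OF this] obtain x0 where "\<forall>i\<in>I. x0 i \<in> X i" ..
  then have "(\<Sum>i\<in>I. ereal (h i (x0 i))) \<le> s"
    unfolding s_def by (intro sum_mono SUP_upper) auto
  moreover obtain z where "z \<in> X a" using insert.prems(1) by auto
  ultimately obtain s' where s': "s = ereal s'"
    using s_le[of z] by (cases s) auto
  have "(SUP x\<in>X a. ereal (h a x)) \<le> ereal (C - s')"
  proof (rule SUP_least)
    fix z assume "z \<in> X a"
    from s_le[OF this] show "ereal (h a z) \<le> ereal (C - s')" by (simp add: s')
  qed
  then have "(SUP x\<in>X a. ereal (h a x)) + s \<le> ereal (C - s') + s"
    by (intro add_right_mono)
  then show ?case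
    using insert.hyps by (simp add: s_def[symmetric]) (simp add: s')
qed

text \<open>Points outside the effective domain contribute -\<infinity> to a conjugate, so its
  supremum runs over real values only and \<open>sum_SUP_le\<close> applies.\<close>

lemma sum_conjugate_le:
  assumes "finite I" and proper: "\<And>i. i \<in> I \<Longrightarrow> proper (N i) (f i)"
    and C: "\<And>x. (\<And>i. i \<in> I \<Longrightarrow> x i \<in> effdom (N i) (f i)) \<Longrightarrow>
      (\<Sum>i\<in>I. (\<Sum>j<N i. u i j * x i j) - real_of_ereal (f i (x i))) \<le> C"
  shows "(\<Sum>i\<in>I. conjugate (N i) (f i) (u i)) \<le> ereal C"
proof -
  have "(\<Sum>i\<in>I. conjugate (N i) (f i) (u i))
      \<le> (\<Sum>i\<in>I. SUP x\<in>effdom (N i) (f i). ereal ((\<Sum>j<N i. u i j * x j) - real_of_ereal (f i x)))"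
  proof (rule sum_mono)
    fix i assume i: "i \<in> I"
    let ?h = "\<lambda>x. (\<Sum>j<N i. u i j * x j) - real_of_ereal (f i x)"
    show "conjugate (N i) (f i) (u i) \<le> (SUP x\<in>effdom (N i) (f i). ereal (?h x))"
      unfolding conjugate_def
    proof (rule SUP_least)
      fix x assume x: "x \<in> Rn (N i)"
      show "ereal (\<Sum>j<N i. u i j * x j) - f i x \<le> (SUP x\<in>effdom (N i) (f i). ereal (?h x))"
      proof (cases "f i x")
        case (real r)
        then have "x \<in> effdom (N i) (f i)" using x by (simp add: effdom_def)
        then have "ereal (?h x) \<le> (SUP x\<in>effdom (N i) (f i). ereal (?h x))" by (rule SUP_upper)
        then show ?thesis by (simp add: real)
      qed (use proper[OF i] x in \<open>auto simp: proper_def\<close>)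
    qed
  qed
  also have "\<dots> \<le> ereal C"
    by (rule sum_SUP_le[OF assms(1)]) (use proper C in \<open>auto simp: proper_def\<close>)
  finally show ?thesis .
qed

text \<open>The negated conjugate at \<open>-A^T y\<close> is the infimum of
  \<open>f x + y \<bullet> A x\<close>, so a lower bound of the Lagrangian at \<open>y\<close>
  bounds the dual objective there.\<close>

lemma dual_value_ge:
  assumes "\<And>i. i \<in> {1..n} \<Longrightarrow> proper (N i) (f i)" and "0 \<le> y"
    and \<beta>: "\<And>x. (\<And>i. i \<in> {1..n} \<Longrightarrow> x i \<in> effdom (N i) (f i)) \<Longrightarrow>
      \<beta> \<le> (\<Sum>i=1..n. y \<bullet> mat_app (N i) (A i) (x i) + real_of_ereal (f i (x i))) - y \<bullet> b"
  shows "ereal \<beta> \<le> dual_value n N f A b"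
proof -
  let ?c = "\<Sum>i=1..n. conjugate (N i) (f i) (\<lambda>j. - transp_app (N i) (A i) y j)"
  have "?c \<le> ereal (- \<beta> - y \<bullet> b)"
  proof (rule sum_conjugate_le)
    fix x assume x: "\<And>i. i \<in> {1..n} \<Longrightarrow> x i \<in> effdom (N i) (f i)"
    have "(\<Sum>i=1..n. (\<Sum>j<N i. - transp_app (N i) (A i) y j * x i j) - real_of_ereal (f i (x i)))
        = - (\<Sum>i=1..n. y \<bullet> mat_app (N i) (A i) (x i) + real_of_ereal (f i (x i)))"
      by (simp add: inner_mat_app sum_negf sum_subtractf sum.distrib)
    then show "(\<Sum>i=1..n. (\<Sum>j<N i. - transp_app (N i) (A i) y j * x i j) - real_of_ereal (f i (x i)))
        \<le> - \<beta> - y \<bullet> b"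
      using \<beta>[of x] x by simp
  qed (use assms in auto)
  then have "ereal \<beta> \<le> - ?c - ereal (b \<bullet> y)"
    by (cases ?c) (auto simp: inner_commute)
  also have "\<dots> \<le> dual_value n N f A b"
    unfolding dual_value_def using assms(2) by (intro SUP_upper) auto
  finally show ?thesis .
qed

section \<open>Weighted means as primal feasible points\<close>

lemma combination_in_Rn:
  assumes "\<And>j. j \<in> J \<Longrightarrow> x j \<in> Rn n"
  shows "(\<lambda>t. \<Sum>j\<in>J. \<alpha> j * x j t) \<in> Rn n"
  using assms by (auto simp: topspace_Euclidean_space intro!: sum.neutral)

text \<open>The weighted sum of values is finite and can be moved to the other side. The value at
  the mean may be \<infinity>, and then the nonconvexity is \<infinity> too.\<close>

lemma le_nonconvexity_plus:
  assumes "proper n f"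
    and x: "\<And>j. j \<in> {1..k} \<Longrightarrow> x j \<in> effdom n f" "\<And>j. j \<in> {1..k} \<Longrightarrow> 0 \<le> \<alpha> j"
      "(\<Sum>j=1..k. \<alpha> j) = 1"
  shows "f (\<lambda>t. \<Sum>j=1..k. \<alpha> j * x j t)
    \<le> nonconvexity n k f + ereal (\<Sum>j=1..k. \<alpha> j * real_of_ereal (f (x j)))"
proof -
  have real: "f (x j) = ereal (real_of_ereal (f (x j)))" if "j \<in> {1..k}" for j
    using x(1)[OF that] assms(1) by (cases "f (x j)") (auto simp: effdom_def proper_def)
  have "(\<Sum>j=1..k. ereal (\<alpha> j) * f (x j)) = (\<Sum>j=1..k. ereal (\<alpha> j * real_of_ereal (f (x j))))"
    by (intro sum.cong refl) (metis real times_ereal.simps(1))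
  also have "\<dots> = ereal (\<Sum>j=1..k. \<alpha> j * real_of_ereal (f (x j)))" by simp
  finally have eq: "(\<Sum>j=1..k. ereal (\<alpha> j) * f (x j)) = \<dots>" .
  have "f (\<lambda>t. \<Sum>j=1..k. \<alpha> j * x j t) - (\<Sum>j=1..k. ereal (\<alpha> j) * f (x j)) \<le> nonconvexity n k f"
    unfolding nonconvexity_def using x by (intro Sup_upper) blast
  then show ?thesis unfolding eq by (simp add: ereal_minus_le)
qed

text \<open>By linearity of \<open>mat_app\<close> the block means satisfy the constraint, and
  passing to the mean costs each block at most its nonconvexity.\<close>

lemma primal_value_le_slot_sums:
  assumes "\<And>i. i \<in> {1..n} \<Longrightarrow> proper (N i) (f i)"
    and "(b, r) \<in> slot_sums {1..n} k (\<lambda>i. effdom (N i) (f i)) (\<lambda>i. mat_app (N i) (A i))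
      (\<lambda>i x. real_of_ereal (f i x))"
  shows "primal_value n N f A b \<le> (\<Sum>i=1..n. nonconvexity (N i) (k i) (f i)) + ereal r"
proof -
  obtain \<alpha> x where x: "\<And>i j. i \<in> {1..n} \<Longrightarrow> j \<in> {1..k i} \<Longrightarrow> x i j \<in> effdom (N i) (f i)"
    and \<alpha>: "\<And>i j. i \<in> {1..n} \<Longrightarrow> j \<in> {1..k i} \<Longrightarrow> 0 \<le> \<alpha> i j"
      "\<And>i. i \<in> {1..n} \<Longrightarrow> (\<Sum>j=1..k i. \<alpha> i j) = 1"
    and le: "(\<Sum>i=1..n. \<Sum>j=1..k i. \<alpha> i j *\<^sub>R mat_app (N i) (A i) (x i j)) \<le> b"
      "(\<Sum>i=1..n. \<Sum>j=1..k i. \<alpha> i j * real_of_ereal (f i (x i j))) \<le> r"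
    using assms(2) unfolding slot_sums_def by blast
  define w where "w i = (\<lambda>t. \<Sum>j=1..k i. \<alpha> i j * x i j t)" for i
  define c where "c i = (\<Sum>j=1..k i. \<alpha> i j * real_of_ereal (f i (x i j)))" for i
  have "w i \<in> Rn (N i)" if "i \<in> {1..n}" for i
    unfolding w_def using x[OF that] by (intro combination_in_Rn) (auto simp: effdom_def)
  moreover have "(\<Sum>i=1..n. mat_app (N i) (A i) (w i)) \<le> b"
    using le(1) by (simp add: w_def mat_app_sum)
  ultimately have "primal_value n N f A b \<le> (\<Sum>i=1..n. f i (w i))"
    unfolding primal_value_def by (intro Inf_lower) blast
  also have "\<dots> \<le> (\<Sum>i=1..n. nonconvexity (N i) (k i) (f i) + ereal (c i))"
    unfolding w_def c_def
    by (rule sum_mono) (rule le_nonconvexity_plus; use assms(1) x \<alpha> in blast)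
  also have "\<dots> = (\<Sum>i=1..n. nonconvexity (N i) (k i) (f i)) + ereal (\<Sum>i=1..n. c i)"
    by (simp add: sum.distrib)
  also have "\<dots> \<le> (\<Sum>i=1..n. nonconvexity (N i) (k i) (f i)) + ereal r"
    using le(2) by (intro add_left_mono) (simp add: c_def)
  finally show ?thesis .
qed

theorem theorem8:
  fixes n :: nat and N :: "nat \<Rightarrow> nat"
    and f :: "nat \<Rightarrow> (nat \<Rightarrow> real) \<Rightarrow> ereal"
    and A :: "nat \<Rightarrow> 'm::finite \<Rightarrow> nat \<Rightarrow> real"
    and b :: "real ^ 'm"
  assumes "\<And>i. i \<in> {1..n} \<Longrightarrow> proper (N i) (f i)"
    and "\<And>i. i \<in> {1..n} \<Longrightarrow> lsc (N i) (f i)"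
    and "\<And>i. i \<in> {1..n} \<Longrightarrow> bounded_Rn (N i) (effdom (N i) (f i))"
    and "primal_value n N f A b < \<infinity>"
  shows "\<exists>k :: nat \<Rightarrow> nat.
    (\<forall>i\<in>{1..n}. 1 \<le> k i \<and> k i \<le> CARD('m) + 1) \<and>
    (\<Sum>i=1..n. k i) \<le> CARD('m) + n \<and>
    primal_value n N f A b - dual_value n N f A b
      \<le> (\<Sum>i=1..n. nonconvexity (N i) (k i) (f i))"
proof (cases "dual_value n N f A b = \<infinity>")
  case True
  \<comment> \<open>In \<open>ereal\<close> the difference \<infinity> - \<infinity> is \<infinity>,
    so primal feasibility is what makes the gap -\<infinity>. Then one point per block,
    \<open>n\<close> in total, will do.\<close>
  then have "primal_value n N f A b - dual_value n N f A b = - \<infinity>"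
    using assms(4) by (cases "primal_value n N f A b") auto
  then show ?thesis by (intro exI[of _ "\<lambda>_. 1"]) simp
next
  case False
  let ?I = "{1..n}" and ?D = "\<lambda>i. effdom (N i) (f i)" and ?g = "\<lambda>i. mat_app (N i) (A i)"
  have "\<forall>i\<in>?I. \<exists>K. compact K \<and> ?D i \<subseteq> K \<and> K \<subseteq> Rn (N i)"
    using assms(3) by (intro ballI bounded_Rn_imp_subset_compact) (auto simp: effdom_def)
  from bchoice[OF this] obtain K where "\<forall>i\<in>?I. compact (K i) \<and> ?D i \<subseteq> K i \<and> K i \<subseteq> Rn (N i)" ..
  then have K: "\<And>i. i \<in> ?I \<Longrightarrow> compact (K i)" "\<And>i. i \<in> ?I \<Longrightarrow> ?D i \<subseteq> K i"
    "\<And>i. i \<in> ?I \<Longrightarrow> K i \<subseteq> Rn (N i)" by blast+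
  have lsc: "lsc_on (K i) (f i)" if "i \<in> ?I" for i
    using assms(2) K(3) that by (blast intro: lsc_imp_lsc_on)
  have ninf: "f i x \<noteq> - \<infinity>" if "i \<in> ?I" "x \<in> K i" for i x
    using assms(1) K(3) that by (auto simp: proper_def)
  have D: "?D i = {x \<in> K i. f i x < \<infinity>}" if "i \<in> ?I" for i
    using K(2,3)[OF that] by (auto simp: effdom_def)
  have "dual_value n N f A b \<noteq> - \<infinity>"
  proof -
    have "\<forall>i\<in>?I. \<exists>M::real. \<forall>x\<in>K i. ereal M < f i x"
      using lsc_on_compact_bounded_below K(1) lsc ninf by blast
    from bchoice[OF this] obtain M where M: "\<forall>i\<in>?I. \<forall>x\<in>K i. ereal (M i) < f i x" ..
    \<comment> \<open>At \<open>y = 0\<close> the Lagrangian is the plain cost, which is bounded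
      below because each \<open>f i\<close> is so on the compact set \<open>K i\<close>.\<close>
    have "ereal (\<Sum>i=1..n. M i) \<le> dual_value n N f A b"
    proof (rule dual_value_ge[where y = 0])
      fix x assume x: "\<And>i. i \<in> ?I \<Longrightarrow> x i \<in> ?D i"
      have "M i \<le> real_of_ereal (f i (x i))" if "i \<in> ?I" for i
        using M x[OF that] D[OF that] that by (cases "f i (x i)") fastforce+
      then show "(\<Sum>i=1..n. M i) \<le> (\<Sum>i=1..n. 0 \<bullet> ?g i (x i) + real_of_ereal (f i (x i))) - 0 \<bullet> b"
        by (auto intro: sum_mono)
    qed (use assms(1) in auto)
    then show ?thesis by auto
  qed
  with False obtain r where r: "dual_value n N f A b = ereal r"
    by (cases "dual_value n N f A b") auto
  obtain x0 where x0: "\<And>i. i \<in> ?I \<Longrightarrow> x0 i \<in> Rn (N i)" "(\<Sum>i=1..n. ?g i (x0 i)) \<le> b"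
    "(\<Sum>i=1..n. f i (x0 i)) < \<infinity>"
    using assms(4) unfolding primal_value_def Inf_less_iff by blast
  have "x0 i \<in> ?D i" if "i \<in> ?I" for i
    using x0(1)[OF that] x0(3) that by (auto simp: effdom_def less_top[symmetric] sum_Pinfty)
  moreover have "\<exists>x. (\<forall>i\<in>?I. x i \<in> ?D i) \<and>
      (\<Sum>i\<in>?I. y \<bullet> ?g i (x i) + real_of_ereal (f i (x i))) - y \<bullet> b < \<beta>"
    if "0 \<le> y" "r < \<beta>" for y \<beta>
  \<comment> \<open>Otherwise \<beta> would bound the Lagrangian at \<open>y\<close> from below, and
    the dual value \<open>r\<close> would be at least \<beta>.\<close>
  proof (rule ccontr)
    assume "\<not> ?thesis"
    then have "\<And>x. (\<And>i. i \<in> ?I \<Longrightarrow> x i \<in> ?D i) \<Longrightarrow>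
        \<beta> \<le> (\<Sum>i\<in>?I. y \<bullet> ?g i (x i) + real_of_ereal (f i (x i))) - y \<bullet> b"
      by (meson not_less)
    with assms(1) that(1) have "ereal \<beta> \<le> dual_value n N f A b"
      by (rule dual_value_ge)
    then show False using that(2) by (simp add: r)
  qed
  ultimately have "\<exists>k. k \<in> ?I \<rightarrow>\<^sub>E {1..DIM(real ^ 'm) + 1} \<and> sum k ?I \<le> DIM(real ^ 'm) + card ?I \<and>
      (b, r) \<in> slot_sums ?I k ?D ?g (\<lambda>i x. real_of_ereal (f i x))"
    using assms(1) x0(2) K(1) lsc ninf D
    by (intro slot_sums_of_dual_bound[where K = K and ?x0.0 = x0])
      (simp_all add: proper_def continuous_on_mat_app)
  then obtain k where k: "k \<in> ?I \<rightarrow>\<^sub>E {1..CARD('m) + 1}" "sum k ?I \<le> CARD('m) + n"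
    "(b, r) \<in> slot_sums ?I k ?D ?g (\<lambda>i x. real_of_ereal (f i x))"
    by auto
  have "primal_value n N f A b - dual_value n N f A b \<le> (\<Sum>i=1..n. nonconvexity (N i) (k i) (f i))"
    using primal_value_le_slot_sums[OF assms(1) k(3)] by (simp add: r ereal_minus_le)
  moreover have "\<forall>i\<in>?I. 1 \<le> k i \<and> k i \<le> CARD('m) + 1"
    using k(1) by (auto dest: PiE_mem)
  ultimately show ?thesis using k(2) by (intro exI[of _ k]) simp
qed

end
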